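(* Let $(V;\rho,\nu)$ be a generalized representation of a $3$-Lie algebra $\mathfrak g$, and let $\mathrm d:C^p_>(\mathfrak g\oplus V,V)\to C^{p+1}_>(\mathfrak g\oplus V,V)$ be given by $\mathrm d(\alpha)=[\pi+\bar\rho+\bar\nu,\alpha]^{\mathrm{3Lie}}$. Then $\mathrm d\circ\mathrm d=0$. Thus one obtains a cochain complex whose space of $p$-cochains is $C^{p-1}_>(\mathfrak g\oplus V,V)$.
   Context: All vector spaces are over an algebraically closed field $\mathbb K$ of characteristic $0$. A $3$-Lie algebra is a vector space $\mathfrak g$ with a skew-symmetric trilinear map $[\cdot,\cdot,\cdot]:\otimes^3\mathfrak g\to\mathfrak g$ satisfying the Fundamental Identity: $[x_1,x_2,[x_3,x_4,x_5]]=[[x_1,x_2,x_3],x_4,x_5]+[x_3,[x_1,x_2,x_4],x_5]+[x_3,x_4,[x_1,x_2,x_5]]$ for all $x_i\in\mathfrak g$. Graded Lie algebra of a vector space $W$. For $p\ge 0$ let $C^p(W,W)$ be the space of linear maps $\alpha:(\wedge^2W)^{\otimes p}\otimes W\to W$ which (for $p\ge1$) are skew-symmetric in the last three arguments, i.e. linear maps on $\wedge^2W\otimes\cdots\otimes\wedge^2W\wedge W$ ($p$ factors $\wedge^2W$). For $\alpha\in C^p(W,W)$, $\beta\in C^q(W,W)$ put $[\alpha,\beta]^{\mathrm{3Lie}}=(-1)^{pq}\alpha\circ\beta-\beta\circ\alpha\in C^{p+q}(W,W)$. Here, for $\mathfrak X_i=x_i\wedge y_i\in\wedge^2W$ ($1\le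 i\le p+q$) and $x\in W$, $$\begin{aligned}\alpha\circ\beta(\mathfrak X_1,\ldots,\mathfrak X_{p+q},x)=&\sum_{J,\,j_{q+1}<p+q+1}(-1)^{(J,I)}(-1)^k\Big(\alpha(\mathfrak X_{i_1},\ldots,\mathfrak X_{i_k},\beta(\mathfrak X_{j_1},\ldots,\mathfrak X_{j_q},x_{j_{q+1}})\wedge y_{j_{q+1}},\mathfrak X_{i_{k+1}},\ldots,\mathfrak X_{i_{p-1}},x)\\&\quad+\alpha(\mathfrak X_{i_1},\ldots,\mathfrak X_{i_k},x_{j_{q+1}}\wedge\beta(\mathfrak X_{j_1},\ldots,\mathfrak X_{j_q},y_{j_{q+1}}),\mathfrak X_{i_{k+1}},\ldots,\mathfrak X_{i_{p-1}},x)\Big)\\&+\sum_{J,\,j_{q+1}=p+q+1}(-1)^{(J,I)}(-1)^p\alpha(\mathfrak X_{i_1},\ldots,\mathfrak X_{i_p},\beta(\mathfrak X_{j_1},\ldots,\mathfrak X_{j_q},x)),\end{aligned}$$ where $J=\{j_1<\cdots<j_{q+1}\}$ runs over the $(q+1)$-element subsets of $N=\{1,\ldots,p+q+1\}$, $I=\{i_1<\cdots<i_p\}=N\setminus J$, $(-1)^{(J,I)}$ is the sign of the permutation $(j_1,\ldots,j_{q+1},i_1,\ldots,i_p)$, and $k$ is determined by $i_k<j_{q+1}<i_{k+1}$ ($k=0$ if $j_{q+1}<i_1$, $k=p-1$ if $j_{q+1}>i_{p-1}$). This makes $\oplus_pC^p(W,W)$ a graded Lie algebra (known fact). Generalized representation.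 Take $W=\mathfrak g\oplus V$. Let $\pi$ be the bracket of $\mathfrak g$ extended by zero: $\pi(x+u,y+v,z+w)=[x,y,z]$. A generalized representation $(V;\rho,\nu)$ of $\mathfrak g$ on a vector space $V$ consists of linear maps $\rho:\wedge^2\mathfrak g\to\mathfrak{gl}(V)$ and $\nu:\mathfrak g\to\mathrm{Hom}(\wedge^2V,V)$ such that $[\pi+\bar\rho+\bar\nu,\pi+\bar\rho+\bar\nu]^{\mathrm{3Lie}}=0$, where $\bar\rho(x+u,y+v,z+w)=\rho(x,y)(w)+\rho(y,z)(u)+\rho(z,x)(v)$ and $\bar\nu(x+u,y+v,z+w)=\nu(x)(v\wedge w)+\nu(y)(w\wedge u)+\nu(z)(u\wedge v)$. Cochains. $C^p(\mathfrak g\oplus V,V)\subset C^p(\mathfrak g\oplus V,\mathfrak g\oplus V)$ is the subspace of $V$-valued cochains, and $C^p_>(\mathfrak g\oplus V,V)$ is the subspace of $C^p(\mathfrak g\oplus V,V)$ with $C^p(\mathfrak g\oplus V,V)=C^p_>(\mathfrak g\oplus V,V)\oplus C^p(V,V)$, i.e. the cochains that vanish whenever all arguments lie in $V$ (and $C^p(V,V)$ is embedded by extension by zero). One has $[\pi+\bar\rho+\bar\nu,C^\bullet_>(\mathfrak g\oplus V,V)]^{\mathrm{3Lie}}\subseteq C^{\bullet+1}_>(\mathfrak g\oplus V,V)$. *)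

theory Defs
  imports
    "HOL-Analysis.Product_Vector"
    "HOL-Library.Function_Algebras"
    "HOL-Computational_Algebra.Polynomial"
    "HOL-Combinatorics.Permutations"
begin

locale three_lie_algebra = vector_space s
  for s :: "'k::field \<Rightarrow> 'g::ab_group_add \<Rightarrow> 'g" +
  fixes br :: "'g \<Rightarrow> 'g \<Rightarrow> 'g \<Rightarrow> 'g"
  assumes linear1: "Vector_Spaces.linear s s (\<lambda>x. br x y z)"
    and linear2: "Vector_Spaces.linear s s (\<lambda>y. br x y z)"
    and linear3: "Vector_Spaces.linear s s (\<lambda>z. br x y z)"
    and skew12: "br y x z = - br x y z"
    and skew23: "br x z y = - br x y z"
    and fundamental_identity:
      "br x1 x2 (br x3 x4 x5) =
         br (br x1 x2 x3) x4 x5 + br x3 (br x1 x2 x4) x5 + br x3 x4 (br x1 x2 x5)"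

text \<open>
  A linear map on \<open>(\<Lambda>\<^sup>2 W)\<^sup>\<otimes>\<^sup>p \<otimes> W\<close> is encoded by the corresponding multilinear map, i.e. by its
  values on the arguments \<open>x\<^sub>1 \<and> y\<^sub>1, \<dots>, x\<^sub>p \<and> y\<^sub>p, x\<close>: the wedges form a list of pairs of length \<open>p\<close>.
  Cochains are \<open>0\<close> on lists of any other length, so that equality of cochains is equality of
  functions and the vector space operations are the pointwise ones.
\<close>

type_synonym 'w cochain = "('w \<times> 'w) list \<Rightarrow> 'w \<Rightarrow> 'w"

definition cochain_scale :: "('k \<Rightarrow> 'w \<Rightarrow> 'w) \<Rightarrow> 'k \<Rightarrow> 'w cochain \<Rightarrow> 'w cochain" where
  "cochain_scale s c \<alpha> = (\<lambda>Xs x. s c (\<alpha> Xs x))"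

text \<open>The space \<open>C\<^sup>p(W,W)\<close>. The last condition, together with skew-symmetry in the last wedge, is
  skew-symmetry in the last three arguments.\<close>

definition cochains :: "('k::field \<Rightarrow> 'w::ab_group_add \<Rightarrow> 'w) \<Rightarrow> nat \<Rightarrow> 'w cochain set" where
  "cochains s p = {\<alpha>.
     (\<forall>Xs x. length Xs \<noteq> p \<longrightarrow> \<alpha> Xs x = 0) \<and>
     (\<forall>Xs. length Xs = p \<longrightarrow> Vector_Spaces.linear s s (\<lambda>x. \<alpha> Xs x)) \<and>
     (\<forall>Xs Ys y z. length Xs + 1 + length Ys = p \<longrightarrow>
        Vector_Spaces.linear s s (\<lambda>x. \<alpha> (Xs @ [(x, y)] @ Ys) z) \<and>
        Vector_Spaces.linear s s (\<lambda>x. \<alpha> (Xs @ [(y, x)] @ Ys) z)) \<and>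
     (\<forall>Xs Ys x y z. length Xs + 1 + length Ys = p \<longrightarrow>
        \<alpha> (Xs @ [(y, x)] @ Ys) z = - \<alpha> (Xs @ [(x, y)] @ Ys) z) \<and>
     (\<forall>Xs x y z. length Xs + 1 = p \<longrightarrow> \<alpha> (Xs @ [(x, z)]) y = - \<alpha> (Xs @ [(x, y)]) z)}"

text \<open>For \<open>J \<subseteq> {0..<n}\<close> with complement \<open>I\<close>, the sign \<open>(-1)\<^sup>(\<^sup>J\<^sup>,\<^sup>I\<^sup>)\<close> of the permutation of \<open>{0..<n}\<close>
  whose list of values consists of \<open>J\<close> in increasing order followed by \<open>I\<close> in increasing order.\<close>

definition shuffle_sign :: "nat \<Rightarrow> nat set \<Rightarrow> int" where
  "shuffle_sign n J =
     sign (\<lambda>m. if m < n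
               then (sorted_list_of_set J @ sorted_list_of_set ({0..<n} - J)) ! m else m)"

text \<open>
  The composition \<open>\<alpha> \<circ> \<beta>\<close> for \<open>\<alpha> \<in> C\<^sup>p(W,W)\<close>, \<open>\<beta> \<in> C\<^sup>q(W,W)\<close>. Indices are shifted down by one, to
  \<open>{0..<p + q + 1}\<close>: an index \<open>i < p + q\<close> stands for the wedge \<open>Xs ! i\<close>, the index \<open>p + q\<close> for the
  final argument. In both sums \<open>js\<close> and \<open>j\<close> are \<open>j\<^sub>1, \<dots>, j\<^sub>q\<close> and \<open>j\<^sub>q\<^sub>+\<^sub>1\<close>. In the first one \<open>p + q\<close>
  is the largest element \<open>i\<^sub>p\<close> of \<open>I\<close> and is dropped, so \<open>is\<close> is \<open>i\<^sub>1, \<dots>, i\<^sub>p\<^sub>-\<^sub>1\<close>.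
\<close>

definition circ ::
  "('k::field \<Rightarrow> 'w::ab_group_add \<Rightarrow> 'w) \<Rightarrow> nat \<Rightarrow> nat \<Rightarrow> 'w cochain \<Rightarrow> 'w cochain \<Rightarrow> 'w cochain" where
  "circ s p q \<alpha> \<beta> = (\<lambda>Xs x.
     if length Xs \<noteq> p + q then 0
     else
       (\<Sum>J | J \<subseteq> {0..<p + q + 1} \<and> card J = q + 1 \<and> Max J < p + q.
          let js = map (\<lambda>i. Xs ! i) (butlast (sorted_list_of_set J));
              j = Max J;
              xj = fst (Xs ! j);
              yj = snd (Xs ! j);
              I = {0..<p + q + 1} - J;
              is = map (\<lambda>i. Xs ! i) (butlast (sorted_list_of_set I));
              k = card {i \<in> I. i < j}
          in s (of_int (shuffle_sign (p + q + 1) J) * (- 1) ^ k)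
               (\<alpha> (take k is @ [(\<beta> js xj, yj)] @ drop k is) x +
                \<alpha> (take k is @ [(xj, \<beta> js yj)] @ drop k is) x))
     + (\<Sum>J | J \<subseteq> {0..<p + q + 1} \<and> card J = q + 1 \<and> Max J = p + q.
          let js = map (\<lambda>i. Xs ! i) (butlast (sorted_list_of_set J));
              I = {0..<p + q + 1} - J;
              is = map (\<lambda>i. Xs ! i) (sorted_list_of_set I)
          in s (of_int (shuffle_sign (p + q + 1) J) * (- 1) ^ p) (\<alpha> is (\<beta> js x))))"

definition bracket_3Lie ::
  "('k::field \<Rightarrow> 'w::ab_group_add \<Rightarrow> 'w) \<Rightarrow> nat \<Rightarrow> nat \<Rightarrow> 'w cochain \<Rightarrow> 'w cochain \<Rightarrow> 'w cochain" where
  "bracket_3Lie s p q \<alpha> \<beta> = cochain_scale s ((- 1) ^ (p * q)) (circ s p q \<alpha> \<beta>) - circ s q p \<beta> \<alpha>"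

definition ternary_cochain :: "('w \<Rightarrow> 'w \<Rightarrow> 'w \<Rightarrow> 'w::ab_group_add) \<Rightarrow> 'w cochain" where
  "ternary_cochain t = (\<lambda>Xs z. case Xs of [(x, y)] \<Rightarrow> t x y z | _ \<Rightarrow> 0)"

definition pi_bar ::
  "('g \<Rightarrow> 'g \<Rightarrow> 'g \<Rightarrow> 'g::ab_group_add) \<Rightarrow> ('g \<times> 'v::ab_group_add) cochain" where
  "pi_bar br = ternary_cochain (\<lambda>(x, u) (y, v) (z, w). (br x y z, 0))"

definition rho_bar ::
  "('g \<Rightarrow> 'g \<Rightarrow> 'v \<Rightarrow> 'v) \<Rightarrow> ('g::ab_group_add \<times> 'v::ab_group_add) cochain" where
  "rho_bar \<rho> = ternary_cochain (\<lambda>(x, u) (y, v) (z, w). (0, \<rho> x y w + \<rho> y z u + \<rho> z x v))"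

definition nu_bar ::
  "('g \<Rightarrow> 'v \<Rightarrow> 'v \<Rightarrow> 'v) \<Rightarrow> ('g::ab_group_add \<times> 'v::ab_group_add) cochain" where
  "nu_bar \<nu> = ternary_cochain (\<lambda>(x, u) (y, v) (z, w). (0, \<nu> x v w + \<nu> y w u + \<nu> z u v))"

text \<open>Here \<open>module_prod.scale sg sv\<close> is the componentwise scalar multiplication of \<open>\<gg> \<oplus> V\<close>.\<close>

locale generalized_representation =
  three_lie_algebra sg br + V: vector_space sv
  for sg :: "'k::field \<Rightarrow> 'g::ab_group_add \<Rightarrow> 'g"
    and br :: "'g \<Rightarrow> 'g \<Rightarrow> 'g \<Rightarrow> 'g"
    and sv :: "'k \<Rightarrow> 'v::ab_group_add \<Rightarrow> 'v" +
  fixes \<rho> :: "'g \<Rightarrow> 'g \<Rightarrow> 'v \<Rightarrow> 'v"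
    and \<nu> :: "'g \<Rightarrow> 'v \<Rightarrow> 'v \<Rightarrow> 'v"
  assumes rho_linear1: "Vector_Spaces.linear sg sv (\<lambda>x. \<rho> x y w)"
    and rho_linear2: "Vector_Spaces.linear sg sv (\<lambda>y. \<rho> x y w)"
    and rho_skew: "\<rho> y x w = - \<rho> x y w"
    and rho_gl: "Vector_Spaces.linear sv sv (\<rho> x y)"
    and nu_linear1: "Vector_Spaces.linear sg sv (\<lambda>x. \<nu> x v w)"
    and nu_linear2: "Vector_Spaces.linear sv sv (\<lambda>v. \<nu> x v w)"
    and nu_linear3: "Vector_Spaces.linear sv sv (\<lambda>w. \<nu> x v w)"
    and nu_skew: "\<nu> x w v = - \<nu> x v w"
    and maurer_cartan:
      "bracket_3Lie (module_prod.scale sg sv) 1 1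
         (pi_bar br + rho_bar \<rho> + nu_bar \<nu>) (pi_bar br + rho_bar \<rho> + nu_bar \<nu>) = 0"

text \<open>\<open>C\<^sup>p(\<gg> \<oplus> V, V)\<close>, and its subspace \<open>C\<^sup>p\<^sub>>(\<gg> \<oplus> V, V)\<close> of the cochains that vanish when all
  arguments lie in \<open>V\<close>.\<close>

definition V_cochains ::
  "('k::field \<Rightarrow> 'g::ab_group_add \<Rightarrow> 'g) \<Rightarrow> ('k \<Rightarrow> 'v::ab_group_add \<Rightarrow> 'v) \<Rightarrow> nat
     \<Rightarrow> ('g \<times> 'v) cochain set" where
  "V_cochains sg sv p = {\<alpha> \<in> cochains (module_prod.scale sg sv) p. \<forall>Xs x. fst (\<alpha> Xs x) = 0}"

definition V_cochains_gt ::
  "('k::field \<Rightarrow> 'g::ab_group_add \<Rightarrow> 'g) \<Rightarrow> ('k \<Rightarrow> 'v::ab_group_add \<Rightarrow> 'v) \<Rightarrow> nat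
     \<Rightarrow> ('g \<times> 'v) cochain set" where
  "V_cochains_gt sg sv p = {\<alpha> \<in> V_cochains sg sv p.
     \<forall>Xs x. (\<forall>(a, b) \<in> set Xs. fst a = 0 \<and> fst b = 0) \<and> fst x = 0 \<longrightarrow> \<alpha> Xs x = 0}"

text \<open>The differential on \<open>C\<^sup>p\<^sub>>(\<gg> \<oplus> V, V)\<close>.\<close>

definition gen_rep_d ::
  "('k::field \<Rightarrow> 'g::ab_group_add \<Rightarrow> 'g) \<Rightarrow> ('k \<Rightarrow> 'v::ab_group_add \<Rightarrow> 'v) \<Rightarrow>
   ('g \<Rightarrow> 'g \<Rightarrow> 'g \<Rightarrow> 'g) \<Rightarrow> ('g \<Rightarrow> 'g \<Rightarrow> 'v \<Rightarrow> 'v) \<Rightarrow> ('g \<Rightarrow> 'v \<Rightarrow> 'v \<Rightarrow> 'v) \<Rightarrow>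
   nat \<Rightarrow> ('g \<times> 'v) cochain \<Rightarrow> ('g \<times> 'v) cochain" where
  "gen_rep_d sg sv br \<rho> \<nu> p \<alpha> =
     bracket_3Lie (module_prod.scale sg sv) 1 p (pi_bar br + rho_bar \<rho> + nu_bar \<nu>) \<alpha>"

text \<open>A cochain complex \<open>C n\<^sub>0 \<rightarrow> C (n\<^sub>0 + 1) \<rightarrow> \<dots>\<close> of subspaces of an ambient vector space.\<close>

definition cochain_complex_from ::
  "nat \<Rightarrow> ('k::field \<Rightarrow> 'c::ab_group_add \<Rightarrow> 'c) \<Rightarrow> (nat \<Rightarrow> 'c set) \<Rightarrow> (nat \<Rightarrow> 'c \<Rightarrow> 'c) \<Rightarrow> bool" where
  "cochain_complex_from n0 s C d \<longleftrightarrow>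
     vector_space s \<and>
     (\<forall>n\<ge>n0. module.subspace s (C n) \<and>
        (\<forall>x\<in>C n. d n x \<in> C (n + 1)) \<and>
        (\<forall>x\<in>C n. \<forall>y\<in>C n. d n (x + y) = d n x + d n y) \<and>
        (\<forall>c. \<forall>x\<in>C n. d n (s c x) = s c (d n x)) \<and>
        (\<forall>x\<in>C n. d (n + 1) (d n x) = 0))"

end

theory Submission
  imports Defs
begin

text \<open>The Maurer-Cartan equation for \<open>\<pi> + \<rho> + \<nu>\<close> says that the bracket with these three components
  makes \<open>W = \<gg> \<oplus> V\<close> a 3-Lie algebra: the self-bracket of a ternary bracket is \<open>-2\<close> times the defect in
  its Fundamental Identity (\<open>fundamental_identity_of_bracket_eq_0\<close>, where characteristic \<open>0\<close> enters;
  \<open>three_lie_algebra_semidirect\<close>). Evaluating the shuffle sums in \<open>[\<omega>, \<alpha>]\<close> for a ternary bracket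
  \<open>\<omega>\<close> shows that \<open>d\<close> is then the coboundary of \<open>W\<close> with coefficients in its adjoint
  representation (\<open>bracket_eq_coboundary\<close>), so that \<open>d \<circ> d = 0\<close> follows without the graded Jacobi
  identity for general cochains.

  For this coboundary, a Cartan calculus reduces \<open>d \<circ> d = 0\<close> to an induction on the number of
  arguments. An element \<open>X = x \<and> y\<close> acts on \<open>W\<close> by \<open>ad X = [x, y, -]\<close>, on wedges by
  \<open>X \<cdot> (a \<and> b) = ad X a \<and> b + a \<and> ad X b\<close>, and hence on cochains by a Lie derivative \<open>L X\<close>. Let
  \<open>i X\<close> be the insertion of \<open>X\<close> as first argument. Then
  \<open>i Y \<circ> L X = L X \<circ> i Y - i (X \<cdot> Y)\<close> and \<open>i X \<circ> d = L X + K X - d \<circ> i X\<close>, where \<open>K X\<close> only sees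
  0-cochains and turns \<open>\<alpha>\<close> into \<open>ad (\<alpha> \<cdot> X)\<close>. The Fundamental Identity gives
  \<open>[L X, L Y] = L (X \<cdot> Y)\<close> and \<open>[L X, K Y] = K (X \<cdot> Y)\<close>, from which \<open>L X\<close> commutes with \<open>d\<close>
  (\<open>lie_deriv_coboundary\<close>), and it gives \<open>d \<circ> K X = 0\<close>, as \<open>ad Z\<close> is a derivation. Therefore
  \<open>i X \<circ> d \<circ> d = L X \<circ> d - d \<circ> L X + d \<circ> d \<circ> i X = d \<circ> d \<circ> i X\<close>, the term \<open>K X \<circ> d\<close> being zero
  because \<open>d \<alpha>\<close> has no component in degree \<open>0\<close>.

  The differential preserves the cochains at hand because \<open>V\<close> is an ideal of \<open>W\<close>
  (\<open>coboundary_in_ideal\<close>) on which the bracket vanishes (\<open>coboundary_vanish_on_abelian\<close>).\<close>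

section \<open>Multilinear cochains of a 3-Lie algebra\<close>

context three_lie_algebra
begin

abbreviation endo :: "('g \<Rightarrow> 'g) \<Rightarrow> bool" where
  "endo f \<equiv> Vector_Spaces.linear s s f"

lemma endo_iff: "endo f \<longleftrightarrow> (\<forall>x y. f (x + y) = f x + f y) \<and> (\<forall>c x. f (s c x) = s c (f x))"
  using vector_space_axioms by (simp add: Vector_Spaces.linear_iff)

lemma br_scale:
  "br (s c x) y z = s c (br x y z)" "br x (s c y) z = s c (br x y z)" "br x y (s c z) = s c (br x y z)"
  using linear1 linear2 linear3 by (auto simp: endo_iff)

lemma br_add:
  "br (x + x') y z = br x y z + br x' y z" "br x (y + y') z = br x y z + br x y' z"
  "br x y (z + z') = br x y z + br x y z'"
  using linear1 linear2 linear3 by (auto simp: endo_iff)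

lemma br_zero [simp]: "br 0 y z = 0" "br x 0 z = 0" "br x y 0 = 0"
  using br_add(1)[of 0 0] br_add(2)[of _ 0 0] br_add(3)[of _ _ 0 0] by auto

lemma br_minus: "br (- x) y z = - br x y z" "br x (- y) z = - br x y z" "br x y (- z) = - br x y z"
  unfolding eq_neg_iff_add_eq_0 by (simp_all flip: br_add)

lemma br_diff:
  "br (x - x') y z = br x y z - br x' y z" "br x (y - y') z = br x y z - br x y' z"
  "br x y (z - z') = br x y z - br x y z'"
  unfolding eq_diff_eq by (simp_all flip: br_add)

abbreviation ad :: "'g \<times> 'g \<Rightarrow> 'g \<Rightarrow> 'g" where
  "ad X \<equiv> br (fst X) (snd X)"

text \<open>A function of pairs with this property is a linear map on \<open>\<Lambda>\<^sup>2 W\<close>. Treating a wedge as one such argument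
  lets one closure argument replace separate inductions for additivity, homogeneity and skew-symmetry.\<close>

definition alt_bilinear :: "('g \<times> 'g \<Rightarrow> 'g) \<Rightarrow> bool" where
  "alt_bilinear f \<longleftrightarrow>
     (\<forall>y. endo (\<lambda>x. f (x, y))) \<and> (\<forall>x. endo (\<lambda>y. f (x, y))) \<and> (\<forall>x y. f (y, x) = - f (x, y))"

definition multilin :: "'g cochain \<Rightarrow> bool" where
  "multilin \<alpha> \<longleftrightarrow>
     (\<forall>Xs. endo (\<alpha> Xs)) \<and> (\<forall>Xs Ys z. alt_bilinear (\<lambda>P. \<alpha> (Xs @ P # Ys) z))"

lemma endo_0: "endo (\<lambda>x. 0)" by (simp add: endo_iff)

lemma endo_add: "endo f \<Longrightarrow> endo g \<Longrightarrow> endo (\<lambda>x. f x + g x)"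
  by (simp add: endo_iff algebra_simps)

lemma endo_diff: "endo f \<Longrightarrow> endo g \<Longrightarrow> endo (\<lambda>x. f x - g x)"
  by (simp add: endo_iff algebra_simps)

lemma endo_comp: "endo f \<Longrightarrow> endo g \<Longrightarrow> endo (\<lambda>x. f (g x))"
  by (simp add: endo_iff)

lemma endo_minus: "endo f \<Longrightarrow> f (- x) = - f x"
  unfolding endo_iff eq_neg_iff_add_eq_0 by (metis add.left_inverse add_cancel_right_left)

lemma alt_bilinearI:
  "(\<And>y. endo (\<lambda>x. f (x, y))) \<Longrightarrow> (\<And>x. endo (\<lambda>y. f (x, y))) \<Longrightarrow> (\<And>x y. f (y, x) = - f (x, y))
    \<Longrightarrow> alt_bilinear f"
  unfolding alt_bilinear_def by blast

lemma alt_bilinearD: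
  assumes "alt_bilinear f"
  shows "endo (\<lambda>x. f (x, y))" "endo (\<lambda>y. f (x, y))" "f (y, x) = - f (x, y)"
  using assms unfolding alt_bilinear_def by blast+

lemma alt_bilinear_0: "alt_bilinear (\<lambda>P. 0)"
  by (simp add: alt_bilinear_def endo_0)

lemma alt_bilinear_add:
  assumes "alt_bilinear f" "alt_bilinear g"
  shows "alt_bilinear (\<lambda>P. f P + g P)"
proof (rule alt_bilinearI)
  show "endo (\<lambda>x. f (x, y) + g (x, y))" "endo (\<lambda>x. f (y, x) + g (y, x))" for y
    by (intro endo_add alt_bilinearD(1,2)[OF assms(1)] alt_bilinearD(1,2)[OF assms(2)])+
  show "f (y, x) + g (y, x) = - (f (x, y) + g (x, y))" for x y
    using assms[THEN alt_bilinearD(3), of y x] by simp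
qed

lemma alt_bilinear_diff:
  assumes "alt_bilinear f" "alt_bilinear g"
  shows "alt_bilinear (\<lambda>P. f P - g P)"
proof (rule alt_bilinearI)
  show "endo (\<lambda>x. f (x, y) - g (x, y))" "endo (\<lambda>x. f (y, x) - g (y, x))" for y
    by (intro endo_diff alt_bilinearD(1,2)[OF assms(1)] alt_bilinearD(1,2)[OF assms(2)])+
  show "f (y, x) - g (y, x) = - (f (x, y) - g (x, y))" for x y
    using assms[THEN alt_bilinearD(3), of y x] by simp
qed

lemma alt_bilinear_comp:
  assumes "endo f" "alt_bilinear g"
  shows "alt_bilinear (\<lambda>P. f (g P))"
proof (rule alt_bilinearI)
  show "endo (\<lambda>x. f (g (x, y)))" "endo (\<lambda>x. f (g (y, x)))" for y
    by (intro endo_comp[OF assms(1)] alt_bilinearD(1,2)[OF assms(2)])+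
  show "f (g (y, x)) = - f (g (x, y))" for x y
    using alt_bilinearD(3)[OF assms(2), of y x] endo_minus[OF assms(1)] by simp
qed

lemma alt_bilinear_deriv:
  assumes "alt_bilinear g" "endo f"
  shows "alt_bilinear (\<lambda>P. g (f (fst P), snd P) + g (fst P, f (snd P)))"
proof -
  note D = alt_bilinearD[OF assms(1)]
  have "g (f y, x) + g (y, f x) = - (g (f x, y) + g (x, f y))" for x y
    using alt_bilinearD(3)[OF assms(1), of x "f y"] alt_bilinearD(3)[OF assms(1), of y "f x"]
    by simp
  moreover have "endo (\<lambda>x. g (f x, y) + g (x, f y))" "endo (\<lambda>x. g (f y, x) + g (y, f x))" for y
    by (rule endo_add[OF endo_comp[OF D(1)[of y] assms(2)] D(1)[of "f y"]],
        rule endo_add[OF D(2)[of "f y"] endo_comp[OF D(2)[of y] assms(2)]])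
  ultimately show ?thesis
    by (intro alt_bilinearI; unfold fst_conv snd_conv; blast)
qed

lemma alt_bilinear_ad: "alt_bilinear (\<lambda>P. ad P z)"
  by (rule alt_bilinearI) (simp_all add: linear1 linear2, rule skew12)

lemma multilin_alt: "multilin \<alpha> \<Longrightarrow> alt_bilinear (\<lambda>P. \<alpha> (Xs @ P # Ys) z)"
  by (simp add: multilin_def)

lemma multilin_slot:
  assumes "multilin \<alpha>"
  shows "\<alpha> ((x + x', y) # Ys) z = \<alpha> ((x, y) # Ys) z + \<alpha> ((x', y) # Ys) z"
    "\<alpha> ((x, y + y') # Ys) z = \<alpha> ((x, y) # Ys) z + \<alpha> ((x, y') # Ys) z"
proof -
  have "alt_bilinear (\<lambda>P. \<alpha> ([] @ P # Ys) z)"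
    using assms unfolding multilin_def by blast
  then have "alt_bilinear (\<lambda>P. \<alpha> (P # Ys) z)"
    by (simp only: append_Nil)
  then show "\<alpha> ((x + x', y) # Ys) z = \<alpha> ((x, y) # Ys) z + \<alpha> ((x', y) # Ys) z"
    "\<alpha> ((x, y + y') # Ys) z = \<alpha> ((x, y) # Ys) z + \<alpha> ((x, y') # Ys) z"
    using alt_bilinearD(1,2) unfolding endo_iff by blast+
qed

lemma multilin_add: "multilin \<alpha> \<Longrightarrow> \<alpha> Xs (x + y) = \<alpha> Xs x + \<alpha> Xs y"
  by (simp add: multilin_def endo_iff)

lemma multilin_diff: "multilin \<alpha> \<Longrightarrow> \<alpha> Xs (x - y) = \<alpha> Xs x - \<alpha> Xs y"
  using multilin_add[of \<alpha> Xs "x - y" y] by simp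

section \<open>Cartan calculus\<close>

text \<open>The insertion \<open>i X\<close> of a first argument. Recursion on the list of arguments through it is what makes
  Cartan's formulas below hold by definition.\<close>

definition contract :: "'g \<times> 'g \<Rightarrow> 'g cochain \<Rightarrow> 'g cochain" where
  "contract X \<alpha> = (\<lambda>Xs. \<alpha> (X # Xs))"

text \<open>The action of \<open>X\<close> on cochains induced by the derivation \<open>ad X\<close>, in recursive form; \<open>lie_deriv_eq_sum\<close> has
  the closed form.\<close>

primrec lie_deriv :: "'g \<times> 'g \<Rightarrow> 'g cochain \<Rightarrow> 'g cochain" where
  "lie_deriv X \<alpha> [] = (\<lambda>z. ad X (\<alpha> [] z) - \<alpha> [] (ad X z))"
| "lie_deriv X \<alpha> (Y # Ys) = (\<lambda>z. lie_deriv X (contract Y \<alpha>) Ys z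
     - \<alpha> ((ad X (fst Y), snd Y) # Ys) z - \<alpha> ((fst Y, ad X (snd Y)) # Ys) z)"

text \<open>The 0-cochain \<open>K X \<alpha> = ad (\<alpha> x \<and> y + x \<and> \<alpha> y)\<close> made from the 0-cochain component of \<open>\<alpha>\<close>, for \<open>X = x \<and> y\<close>.
  It collects the terms of the coboundary in which a value of \<open>\<alpha>\<close> enters a wedge.\<close>

definition adjoint_part :: "'g \<times> 'g \<Rightarrow> 'g cochain \<Rightarrow> 'g cochain" where
  "adjoint_part X \<alpha> Ys = (\<lambda>z. if Ys = []
     then br (\<alpha> [] (fst X)) (snd X) z + br (fst X) (\<alpha> [] (snd X)) z else 0)"

text \<open>The recursion is Cartan's formula. It treats all degrees at once, so that no degree has to be carried
  along; for a cochain of degree \<open>p\<close> only lists of length \<open>p + 1\<close> give a nonzero value.\<close>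

primrec coboundary :: "'g cochain \<Rightarrow> 'g cochain" where
  "coboundary \<alpha> [] = (\<lambda>z. 0)"
| "coboundary \<alpha> (X # Xs) = (\<lambda>z. lie_deriv X \<alpha> Xs z + adjoint_part X \<alpha> Xs z - coboundary (contract X \<alpha>) Xs z)"

lemma contract_apply: "contract X \<alpha> Xs = \<alpha> (X # Xs)"
  by (simp add: contract_def)

lemma contract_lie_deriv:
  "contract Y (lie_deriv X \<alpha>) = lie_deriv X (contract Y \<alpha>) - contract (ad X (fst Y), snd Y) \<alpha> - contract (fst Y, ad X (snd Y)) \<alpha>"
  by (auto simp: contract_def fun_eq_iff)

lemma contract_coboundary:
  "contract X (coboundary \<alpha>) = lie_deriv X \<alpha> + adjoint_part X \<alpha> - coboundary (contract X \<alpha>)"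
  by (auto simp: contract_def fun_eq_iff)

lemma contract_algebra [simp]:
  "contract X 0 = 0" "contract X (\<alpha> + \<beta>) = contract X \<alpha> + contract X \<beta>" "contract X (\<alpha> - \<beta>) = contract X \<alpha> - contract X \<beta>"
  "contract X (cochain_scale s c \<alpha>) = cochain_scale s c (contract X \<alpha>)"
  by (auto simp: contract_def fun_eq_iff cochain_scale_def)

lemma lie_deriv_zero [simp]: "lie_deriv X 0 = 0"
proof -
  have "contract Y (\<lambda>Xs z. 0) = (\<lambda>Xs z. 0)" for Y :: "'g \<times> 'g" by (simp add: contract_def)
  then have "lie_deriv X (\<lambda>Xs z. 0) Ys z = 0" for Ys z
    by (induction Ys) auto
  then show ?thesis by (simp add: fun_eq_iff func_zero)
qed

lemma lie_deriv_add: "lie_deriv X (\<alpha> + \<beta>) = lie_deriv X \<alpha> + lie_deriv X \<beta>"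
proof -
  have "lie_deriv X (\<alpha> + \<beta>) Ys z = lie_deriv X \<alpha> Ys z + lie_deriv X \<beta> Ys z" for Ys z
    by (induction Ys arbitrary: \<alpha> \<beta>) (auto simp: br_add)
  then show ?thesis by (simp add: fun_eq_iff)
qed

lemma lie_deriv_diff: "lie_deriv X (\<alpha> - \<beta>) = lie_deriv X \<alpha> - lie_deriv X \<beta>"
  using lie_deriv_add[of X "\<alpha> - \<beta>" \<beta>] by (simp add: algebra_simps)

lemma lie_deriv_scale:
  "lie_deriv X (cochain_scale s c \<alpha>) = cochain_scale s c (lie_deriv X \<alpha>)"
proof -
  have "lie_deriv X (cochain_scale s c \<alpha>) Ys z = s c (lie_deriv X \<alpha> Ys z)" for Ys z
    by (induction Ys arbitrary: \<alpha>) (auto simp: br_scale cochain_scale_def algebra_simps contract_algebra(4)[unfolded cochain_scale_def])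
  then show ?thesis by (simp add: fun_eq_iff cochain_scale_def)
qed

lemma adjoint_part_zero [simp]: "adjoint_part X 0 = 0"
  by (auto simp: adjoint_part_def fun_eq_iff)

lemma adjoint_part_add: "adjoint_part X (\<alpha> + \<beta>) = adjoint_part X \<alpha> + adjoint_part X \<beta>"
  by (auto simp: adjoint_part_def fun_eq_iff br_add)

lemma adjoint_part_scale: "adjoint_part X (cochain_scale s c \<alpha>) = cochain_scale s c (adjoint_part X \<alpha>)"
  by (auto simp: adjoint_part_def fun_eq_iff br_scale cochain_scale_def scale_right_distrib)

lemma coboundary_zero [simp]: "coboundary 0 = 0"
proof -
  have "coboundary 0 Ys z = 0" for Ys z
    by (induction Ys) (simp_all only: coboundary.simps contract_algebra lie_deriv_zero adjoint_part_zero, simp_all)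
  then show ?thesis by (simp add: fun_eq_iff func_zero)
qed

lemma coboundary_add: "coboundary (\<alpha> + \<beta>) = coboundary \<alpha> + coboundary \<beta>"
proof -
  have "coboundary (\<alpha> + \<beta>) Ys z = coboundary \<alpha> Ys z + coboundary \<beta> Ys z" for Ys z
    by (induction Ys arbitrary: \<alpha> \<beta>) (auto simp: lie_deriv_add adjoint_part_add)
  then show ?thesis by (simp add: fun_eq_iff)
qed

lemma coboundary_diff: "coboundary (\<alpha> - \<beta>) = coboundary \<alpha> - coboundary \<beta>"
  using coboundary_add[of "\<alpha> - \<beta>" \<beta>] by (simp add: algebra_simps)

lemma coboundary_scale:
  "coboundary (cochain_scale s c \<alpha>) = cochain_scale s c (coboundary \<alpha>)"
proof -
  have "coboundary (cochain_scale s c \<alpha>) Ys z = s c (coboundary \<alpha> Ys z)" for Ys z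
    by (induction Ys arbitrary: \<alpha>)
      (auto simp: lie_deriv_scale adjoint_part_scale, simp add: cochain_scale_def algebra_simps)
  then show ?thesis by (simp add: fun_eq_iff cochain_scale_def)
qed

lemma multilin_contract: "multilin \<alpha> \<Longrightarrow> multilin (contract X \<alpha>)"
  unfolding multilin_def contract_def by (auto simp flip: append_Cons)

text \<open>On values and on single vectors this is the Fundamental Identity, \<open>[ad X, ad Y] = ad (X \<cdot> Y)\<close>. The mixed
  terms, in which \<open>X\<close> and \<open>Y\<close> act on different arguments, are symmetric in \<open>X\<close> and \<open>Y\<close> and cancel.\<close>

lemma lie_deriv_commutator:
  assumes "multilin \<alpha>"
  shows "lie_deriv X (lie_deriv Y \<alpha>) = lie_deriv Y (lie_deriv X \<alpha>)
    + lie_deriv (ad X (fst Y), snd Y) \<alpha> + lie_deriv (fst Y, ad X (snd Y)) \<alpha>"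
proof -
  have "lie_deriv X (lie_deriv Y \<alpha>) Zs z = lie_deriv Y (lie_deriv X \<alpha>) Zs z
    + lie_deriv (ad X (fst Y), snd Y) \<alpha> Zs z + lie_deriv (fst Y, ad X (snd Y)) \<alpha> Zs z" for Zs z
    using assms
  proof (induction Zs arbitrary: \<alpha>)
    case Nil
    have FI: "ad X (ad Y w) = br (ad X (fst Y)) (snd Y) w + br (fst Y) (ad X (snd Y)) w + ad Y (ad X w)" for w
      by (rule fundamental_identity)
    show ?case
      by (simp add: br_diff multilin_diff[OF Nil] FI multilin_add[OF Nil])
  next
    case (Cons Z Zs)
    have FI: "ad X (ad Y w) = br (ad X (fst Y)) (snd Y) w + br (fst Y) (ad X (snd Y)) w + ad Y (ad X w)" for w
      by (rule fundamental_identity)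
    have "lie_deriv X (lie_deriv Y (contract Z \<alpha>)) Zs z = lie_deriv Y (lie_deriv X (contract Z \<alpha>)) Zs z
      + lie_deriv (ad X (fst Y), snd Y) (contract Z \<alpha>) Zs z + lie_deriv (fst Y, ad X (snd Y)) (contract Z \<alpha>) Zs z"
      by (rule Cons.IH[OF multilin_contract[OF Cons.prems]])
    then show ?case
      by (simp add: contract_lie_deriv lie_deriv_diff FI multilin_slot[OF Cons.prems] contract_apply)
  qed
  then show ?thesis by (simp add: fun_eq_iff)
qed

lemma lie_deriv_vanish: "(\<And>Ys z. length Ys = length Xs \<Longrightarrow> \<alpha> Ys z = 0) \<Longrightarrow> lie_deriv X \<alpha> Xs z = 0"
  by (induction Xs arbitrary: \<alpha>) (auto simp: contract_def)

text \<open>\<open>ad X\<close> is a derivation of the bracket, so \<open>X\<close> acts on \<open>ad (\<alpha> \<cdot> Y)\<close> through \<open>\<alpha>\<close> and through \<open>Y\<close>.\<close>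

lemma lie_deriv_adjoint_part:
  "lie_deriv X (adjoint_part Y \<alpha>) = adjoint_part Y (lie_deriv X \<alpha>)
    + adjoint_part (ad X (fst Y), snd Y) \<alpha> + adjoint_part (fst Y, ad X (snd Y)) \<alpha>"
proof -
  have "lie_deriv X (adjoint_part Y \<alpha>) Zs z = adjoint_part Y (lie_deriv X \<alpha>) Zs z
    + adjoint_part (ad X (fst Y), snd Y) \<alpha> Zs z + adjoint_part (fst Y, ad X (snd Y)) \<alpha> Zs z" for Zs z
  proof (cases Zs)
    case Nil
    then show ?thesis
      by (simp add: adjoint_part_def br_diff br_add fundamental_identity[of "fst X" "snd X" "fst Y"]
          fundamental_identity[of "fst X" "snd X" _ "snd Y"] algebra_simps)
  next
    case (Cons Z Zs')
    then have "lie_deriv X (adjoint_part Y \<alpha>) Zs z = 0" by (intro lie_deriv_vanish) (auto simp: adjoint_part_def)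
    then show ?thesis using Cons by (simp add: adjoint_part_def)
  qed
  then show ?thesis by (simp add: fun_eq_iff)
qed

text \<open>Inserting \<open>Y\<close> on both sides and applying Cartan's formulas, the terms with \<open>L\<close> and \<open>K\<close> match by the two
  commutator lemmas, and those with \<open>d\<close> by the induction hypothesis for \<open>contract Y \<alpha>\<close>.\<close>

lemma lie_deriv_coboundary:
  assumes "multilin \<alpha>"
  shows "lie_deriv X (coboundary \<alpha>) = coboundary (lie_deriv X \<alpha>)"
proof -
  have "lie_deriv X (coboundary \<alpha>) Ys z = coboundary (lie_deriv X \<alpha>) Ys z" for Ys z
    using assms
  proof (induction Ys arbitrary: \<alpha>)
    case (Cons Y Ys)
    have IH: "lie_deriv X (coboundary (contract Y \<alpha>)) Ys z = coboundary (lie_deriv X (contract Y \<alpha>)) Ys z"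
      by (rule Cons.IH[OF multilin_contract[OF Cons.prems]])
    have "lie_deriv X (coboundary \<alpha>) (Y # Ys) z = contract Y (lie_deriv X (coboundary \<alpha>)) Ys z"
      by (simp add: contract_def)
    also have "\<dots> = contract Y (coboundary (lie_deriv X \<alpha>)) Ys z"
      using IH
      by (simp add: contract_lie_deriv contract_coboundary lie_deriv_commutator[OF Cons.prems, of X Y]
          lie_deriv_adjoint_part[of X Y] lie_deriv_diff lie_deriv_add coboundary_diff coboundary_add)
    finally show ?case by (simp add: contract_def)
  qed simp
  then show ?thesis by (simp add: fun_eq_iff)
qed

text \<open>The maps \<open>ad Z\<close> are derivations, which is what closedness of a 0-cochain means.\<close>

lemma coboundary_adjoint_part: "coboundary (adjoint_part X \<alpha>) = 0"
proof -
  have i: "contract Y (adjoint_part X \<alpha>) = 0" for Y by (auto simp: contract_def adjoint_part_def fun_eq_iff)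
  have "coboundary (adjoint_part X \<alpha>) (Y # Ys) z = 0" for Y Ys z
  proof (cases Ys)
    case Nil
    then show ?thesis
      by (simp add: i adjoint_part_def br_add fundamental_identity[of "\<alpha> [] (fst X)" "snd X" "fst Y" "snd Y" z]
          fundamental_identity[of "fst X" "\<alpha> [] (snd X)" "fst Y" "snd Y" z] algebra_simps)
  next
    case (Cons Z Zs)
    then have "lie_deriv Y (adjoint_part X \<alpha>) Ys z = 0"
      by (intro lie_deriv_vanish) (auto simp: adjoint_part_def)
    then show ?thesis using Cons by (simp add: i) (simp add: adjoint_part_def)
  qed
  then have "coboundary (adjoint_part X \<alpha>) Ys z = 0" for Ys z by (cases Ys) auto
  then show ?thesis by (simp add: fun_eq_iff)
qed

lemma coboundary_coboundary: assumes "multilin \<alpha>" shows "coboundary (coboundary \<alpha>) = 0"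
proof -
  have "coboundary (coboundary \<alpha>) Ys z = 0" for Ys z
    using assms
  proof (induction Ys arbitrary: \<alpha>)
    case (Cons X Ys)
    have "adjoint_part X (coboundary \<alpha>) Ys z = 0" by (simp add: adjoint_part_def)
    then show ?case
      using Cons.IH[OF multilin_contract[OF Cons.prems], of X]
      by (simp add: contract_coboundary lie_deriv_coboundary[OF Cons.prems] coboundary_diff coboundary_add coboundary_adjoint_part)
  qed simp
  then show ?thesis by (simp add: fun_eq_iff)
qed

section \<open>Cochain spaces preserved by the coboundary\<close>

text \<open>In the next lemmas a whole cochain depends on the wedge \<open>P\<close>; they are applied to \<open>A P = contract P \<alpha>\<close>.\<close>

lemma lie_deriv_alt_arg:
  assumes "\<And>Xs z. alt_bilinear (\<lambda>P. A P Xs z)"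
  shows "alt_bilinear (\<lambda>P. lie_deriv X (A P) Ys z)"
  using assms
proof (induction Ys arbitrary: A z)
  case Nil
  then show ?case by (simp add: alt_bilinear_diff alt_bilinear_comp[OF linear3])
next
  case (Cons Y Ys)
  then show ?case by (simp add: contract_def alt_bilinear_diff)
qed

lemma lie_deriv_alt_field:
  assumes "multilin \<alpha>"
  shows "alt_bilinear (\<lambda>P. lie_deriv P \<alpha> Ys z)"
  using assms
proof (induction Ys arbitrary: \<alpha> z)
  case Nil
  then show ?case by (simp add: multilin_def alt_bilinear_diff alt_bilinear_comp[of "\<alpha> []"] alt_bilinear_comp[OF linear3] alt_bilinear_ad)
next
  case (Cons Y Ys)
  have 1: "endo (\<lambda>x. \<alpha> ((x, snd Y) # Ys) z)" "endo (\<lambda>x. \<alpha> ((fst Y, x) # Ys) z)"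
    using alt_bilinearD(1,2)[OF multilin_alt[OF Cons.prems, of "[]" Ys z]] by simp_all
  show ?case using Cons
    by (simp add: alt_bilinear_diff alt_bilinear_comp[OF 1(1)] alt_bilinear_comp[OF 1(2)] alt_bilinear_ad multilin_contract)
qed

lemma adjoint_part_alt: assumes "multilin \<alpha>" shows "alt_bilinear (\<lambda>P. adjoint_part P \<alpha> Ys z)"
proof -
  have e: "endo (\<alpha> [])" using assms by (simp add: multilin_def)
  have "alt_bilinear (\<lambda>P. ad (\<alpha> [] (fst P), snd P) z + ad (fst P, \<alpha> [] (snd P)) z)"
    by (rule alt_bilinear_deriv[OF alt_bilinear_ad e])
  then show ?thesis by (cases Ys) (simp_all add: adjoint_part_def alt_bilinear_0)
qed

lemma adjoint_part_alt_arg: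
  assumes "\<And>Xs z. alt_bilinear (\<lambda>P. A P Xs z)"
  shows "alt_bilinear (\<lambda>P. adjoint_part X (A P) Ys z)"
  by (cases Ys) (simp_all add: adjoint_part_def alt_bilinear_0 alt_bilinear_add
      alt_bilinear_comp[OF linear1 assms] alt_bilinear_comp[OF linear2 assms])

lemma coboundary_alt_arg:
  assumes "\<And>Xs z. alt_bilinear (\<lambda>P. A P Xs z)"
  shows "alt_bilinear (\<lambda>P. coboundary (A P) Ys z)"
  using assms
proof (induction Ys arbitrary: A z)
  case Nil
  then show ?case by (simp add: alt_bilinear_0)
next
  case (Cons Y Ys)
  then show ?case
    by (simp add: contract_def alt_bilinear_diff alt_bilinear_add lie_deriv_alt_arg adjoint_part_alt_arg)
qed

lemma lie_deriv_endo: "(\<And>Xs. endo (\<alpha> Xs)) \<Longrightarrow> endo (lie_deriv X \<alpha> Ys)"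
proof (induction Ys arbitrary: \<alpha>)
  case Nil
  then have "endo (\<alpha> [])" by blast
  then show ?case by (simp add: endo_iff br_add br_scale scale_right_diff_distrib)
qed (auto simp: contract_def intro!: endo_diff)

lemma coboundary_endo: "(\<And>Xs. endo (\<alpha> Xs)) \<Longrightarrow> endo (coboundary \<alpha> Ys)"
proof (induction Ys arbitrary: \<alpha>)
  case (Cons Y Ys)
  have "endo (adjoint_part Y \<alpha> Ys)"
    by (cases Ys) (simp_all add: adjoint_part_def endo_0 linear3 endo_add)
  with Cons show ?case by (auto simp: contract_def intro!: endo_diff endo_add lie_deriv_endo)
qed (simp add: endo_0)

lemma multilin_lie_deriv: assumes "multilin \<alpha>" shows "multilin (lie_deriv X \<alpha>)"
proof -
  have "alt_bilinear (\<lambda>P. lie_deriv X \<alpha> (Xs @ P # Ys) z)" for Xs Ys z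
    using assms
  proof (induction Xs arbitrary: \<alpha>)
    case Nil
    have a: "alt_bilinear (\<lambda>P. \<alpha> (P # Ys) z)" for Ys z using multilin_alt[OF Nil, of "[]"] by simp
    have "alt_bilinear (\<lambda>P. lie_deriv X (contract P \<alpha>) Ys z)"
      by (intro lie_deriv_alt_arg) (simp add: contract_def a)
    from alt_bilinear_diff[OF this alt_bilinear_deriv[OF a linear3[of "fst X" "snd X"]]]
    show ?case by (simp add: diff_diff_add)
  next
    case (Cons Z Zs)
    have "alt_bilinear (\<lambda>P. \<alpha> (Z' # Zs @ P # Ys) z)" for Z'
      using multilin_alt[OF Cons.prems, of "Z' # Zs" Ys z] by simp
    then show ?case
      using Cons.IH[OF multilin_contract[OF Cons.prems]] by (simp add: alt_bilinear_diff)
  qed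
  moreover have "endo (lie_deriv X \<alpha> Xs)" for Xs
    using assms by (intro lie_deriv_endo) (simp add: multilin_def)
  ultimately show ?thesis by (simp add: multilin_def)
qed

lemma multilin_coboundary: assumes "multilin \<alpha>" shows "multilin (coboundary \<alpha>)"
proof -
  have "alt_bilinear (\<lambda>P. coboundary \<alpha> (Xs @ P # Ys) z)" for Xs Ys z
    using assms
  proof (induction Xs arbitrary: \<alpha>)
    case Nil
    have "alt_bilinear (\<lambda>P. coboundary (contract P \<alpha>) Ys z)"
      by (intro coboundary_alt_arg) (use multilin_alt[OF Nil, of "[]"] in \<open>simp add: contract_def\<close>)
    then show ?case using Nil by (simp add: alt_bilinear_diff alt_bilinear_add lie_deriv_alt_field adjoint_part_alt)
  next
    case (Cons Z Zs)
    show ?case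
      using Cons.IH[OF multilin_contract[OF Cons.prems]] multilin_alt[OF multilin_lie_deriv[OF Cons.prems], where Xs = Zs]
      by (simp add: adjoint_part_def alt_bilinear_diff)
  qed
  moreover have "endo (coboundary \<alpha> Xs)" for Xs
    using assms by (intro coboundary_endo) (simp add: multilin_def)
  ultimately show ?thesis by (simp add: multilin_def)
qed

lemma coboundary_vanish:
  "(\<And>Ys z. Suc (length Ys) = length Xs \<Longrightarrow> \<alpha> Ys z = 0) \<Longrightarrow> coboundary \<alpha> Xs z = 0"
proof (induction Xs arbitrary: \<alpha>)
  case (Cons X Xs)
  have "lie_deriv X \<alpha> Xs z = 0" using Cons.prems by (intro lie_deriv_vanish) simp
  moreover have "adjoint_part X \<alpha> Xs z = 0" using Cons.prems by (simp add: adjoint_part_def)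
  moreover have "coboundary (contract X \<alpha>) Xs z = 0" using Cons.prems by (intro Cons.IH) (simp add: contract_apply)
  ultimately show ?case by simp
qed simp

text \<open>Together with skew-symmetry of the last wedge, this is skew-symmetry in the last three arguments.\<close>

definition skew_last :: "'g cochain \<Rightarrow> bool" where
  "skew_last \<alpha> \<longleftrightarrow> (\<forall>Xs x y z. \<alpha> (Xs @ [(x, z)]) y = - \<alpha> (Xs @ [(x, y)]) z)"

lemma skew_lastD: "skew_last \<alpha> \<Longrightarrow> \<alpha> (Xs @ [(x, z)]) y = - \<alpha> (Xs @ [(x, y)]) z"
  unfolding skew_last_def by blast

lemma skew_last_contract: "skew_last \<alpha> \<Longrightarrow> skew_last (contract X \<alpha>)"
  unfolding skew_last_def contract_def by (metis append_Cons)

lemma skew_last_lie_deriv: assumes "skew_last \<alpha>" shows "skew_last (lie_deriv X \<alpha>)"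
proof -
  have "lie_deriv X \<alpha> (Xs @ [(x, z)]) y = - lie_deriv X \<alpha> (Xs @ [(x, y)]) z" for Xs x y z
    using assms
  proof (induction Xs arbitrary: \<alpha>)
    case Nil
    note sk = skew_lastD[OF Nil, of "[]", simplified]
    show ?case
      using sk[of x z y] sk[of x z "ad X y"] sk[of "ad X x" z y] sk[of x "ad X z" y]
      by (simp add: contract_apply br_minus)
  next
    case (Cons Z Zs)
    have IH: "lie_deriv X (contract Z \<alpha>) (Zs @ [(x, z)]) y = - lie_deriv X (contract Z \<alpha>) (Zs @ [(x, y)]) z"
      by (rule Cons.IH[OF skew_last_contract[OF Cons.prems]])
    show ?case
      using skew_lastD[OF Cons.prems, of "Z' # Zs" x z y for Z', simplified]
      by (simp add: IH)
  qed
  then show ?thesis unfolding skew_last_def by blast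
qed

text \<open>In degree \<open>0\<close> the skew-symmetry comes from that of the bracket, and \<open>\<alpha>\<close> has to be an odd map; this is where
  multilinearity enters.\<close>

lemma skew_last_coboundary: assumes "multilin \<alpha>" "skew_last \<alpha>" shows "skew_last (coboundary \<alpha>)"
proof -
  have "coboundary \<alpha> (Xs @ [(x, z)]) y = - coboundary \<alpha> (Xs @ [(x, y)]) z" for Xs x y z
    using assms
  proof (induction Xs arbitrary: \<alpha>)
    case Nil
    show ?case
      using endo_minus[of "\<alpha> []"] Nil(1)[unfolded multilin_def]
      by (simp add: adjoint_part_def skew23[of _ z y] skew23[of x "\<alpha> [] z" y] skew23[of x z "\<alpha> [] y"] br_minus)
  next
    case (Cons Z Zs)
    have IH: "coboundary (contract Z \<alpha>) (Zs @ [(x, z)]) y = - coboundary (contract Z \<alpha>) (Zs @ [(x, y)]) z"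
      by (rule Cons.IH[OF multilin_contract[OF Cons.prems(1)] skew_last_contract[OF Cons.prems(2)]])
    show ?case
      using skew_lastD[OF skew_last_lie_deriv[OF Cons.prems(2)], of Z Zs x z y]
      by (simp add: IH adjoint_part_def)
  qed
  then show ?thesis unfolding skew_last_def by blast
qed

lemma coboundary_in_ideal:
  assumes U: "subspace U" and ideal: "\<And>x y u. u \<in> U \<Longrightarrow> br x y u \<in> U"
    and "\<And>Xs z. \<alpha> Xs z \<in> U"
  shows "coboundary \<alpha> Xs z \<in> U"
proof -
  have L: "lie_deriv X \<alpha> Xs z \<in> U" if "\<And>Xs z. \<alpha> Xs z \<in> U" for X \<alpha> Xs z
    using that by (induction Xs arbitrary: \<alpha> z) (auto simp: contract_apply intro!: subspace_diff[OF U] ideal)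
  have "br u y z \<in> U" "br x u z \<in> U" if "u \<in> U" for u x y z
    using ideal[OF that, of y z] ideal[OF subspace_neg[OF U that], of x z] skew12[of y u z] skew23[of y u z] skew23[of x u z]
    by (simp_all add: br_minus)
  then have K: "adjoint_part X \<alpha> Xs z \<in> U" if "\<And>Xs z. \<alpha> Xs z \<in> U" for X \<alpha> Xs z
    using that by (auto simp: adjoint_part_def intro!: subspace_add[OF U] subspace_0[OF U])
  show ?thesis
    using assms(3)
    by (induction Xs arbitrary: \<alpha>)
      (auto simp: contract_apply intro!: subspace_diff[OF U] subspace_add[OF U] subspace_0[OF U] L K)
qed

lemma coboundary_vanish_on_abelian:
  assumes "0 \<in> A" and abelian: "\<And>x y z. x \<in> A \<Longrightarrow> y \<in> A \<Longrightarrow> z \<in> A \<Longrightarrow> br x y z = 0"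
    and "\<And>Xs z. set Xs \<subseteq> A \<times> A \<Longrightarrow> z \<in> A \<Longrightarrow> \<alpha> Xs z = 0"
    and "set Xs \<subseteq> A \<times> A" "z \<in> A"
  shows "coboundary \<alpha> Xs z = 0"
proof -
  have L: "lie_deriv X \<alpha> Xs z = 0"
    if "X \<in> A \<times> A" "\<And>Xs z. set Xs \<subseteq> A \<times> A \<Longrightarrow> z \<in> A \<Longrightarrow> \<alpha> Xs z = 0" "set Xs \<subseteq> A \<times> A" "z \<in> A"
    for X \<alpha> Xs z
    using that(2-) by (induction Xs arbitrary: \<alpha>) (use that(1) in \<open>auto simp: contract_apply abelian assms(1)\<close>)
  have K: "adjoint_part X \<alpha> Xs z = 0"
    if "X \<in> A \<times> A" "\<And>Xs z. set Xs \<subseteq> A \<times> A \<Longrightarrow> z \<in> A \<Longrightarrow> \<alpha> Xs z = 0"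
    for X \<alpha> Xs z
    using that by (auto simp: adjoint_part_def)
  show ?thesis
    using assms(3-) by (induction Xs arbitrary: \<alpha>) (auto simp: contract_apply L K)
qed

section \<open>Closed forms\<close>

lemma lie_deriv_eq_sum:
  "lie_deriv X \<alpha> Ys z = ad X (\<alpha> Ys z)
     - (\<Sum>c<length Ys. \<alpha> (Ys[c := (ad X (fst (Ys ! c)), snd (Ys ! c))]) z
          + \<alpha> (Ys[c := (fst (Ys ! c), ad X (snd (Ys ! c)))]) z)
     - \<alpha> Ys (ad X z)"
proof (induction Ys arbitrary: \<alpha>)
  case (Cons Y Ys)
  have IH: "lie_deriv X (contract Y \<alpha>) Ys z = ad X (contract Y \<alpha> Ys z)
     - (\<Sum>c<length Ys. contract Y \<alpha> (Ys[c := (ad X (fst (Ys ! c)), snd (Ys ! c))]) z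
          + contract Y \<alpha> (Ys[c := (fst (Ys ! c), ad X (snd (Ys ! c)))]) z)
     - contract Y \<alpha> Ys (ad X z)"
    by (rule Cons.IH)
  show ?case
    by (simp add: IH contract_apply sum.lessThan_Suc_shift del: sum.lessThan_Suc)
qed simp

text \<open>The closed form to be compared with the shuffle sums: the \<open>a\<close>-th wedge acts on all arguments to its right,
  and only the last wedge contributes its adjoint part.\<close>

lemma coboundary_eq_sum:
  "coboundary \<alpha> Xs z =
     (\<Sum>a<length Xs. s ((- 1) ^ a) (lie_deriv (Xs ! a) (\<lambda>Zs. \<alpha> (take a Xs @ Zs)) (drop (Suc a) Xs) z))
     + (if Xs = [] then 0 else s ((- 1) ^ (length Xs - 1))
          (br (\<alpha> (butlast Xs) (fst (last Xs))) (snd (last Xs)) z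
            + br (fst (last Xs)) (\<alpha> (butlast Xs) (snd (last Xs))) z))"
proof (induction Xs arbitrary: \<alpha>)
  case (Cons X Xs)
  have IH: "coboundary (contract X \<alpha>) Xs z =
     (\<Sum>a<length Xs. s ((- 1) ^ a) (lie_deriv (Xs ! a) (\<lambda>Zs. contract X \<alpha> (take a Xs @ Zs)) (drop (Suc a) Xs) z))
     + (if Xs = [] then 0 else s ((- 1) ^ (length Xs - 1))
          (br (contract X \<alpha> (butlast Xs) (fst (last Xs))) (snd (last Xs)) z
            + br (fst (last Xs)) (contract X \<alpha> (butlast Xs) (snd (last Xs))) z))"
    by (rule Cons.IH)
  show ?case
  proof (cases Xs)
    case Nil
    then show ?thesis by (simp add: adjoint_part_def)
  next
    case (Cons Y Ys)
    then have "(- 1 :: 'k) ^ length Xs = - ((- 1) ^ (length Xs - 1))" "Xs \<noteq> []" by auto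
    then show ?thesis
      by (simp add: IH contract_apply adjoint_part_def sum.lessThan_Suc_shift sum_negf del: sum.lessThan_Suc)
  qed
qed simp

end

section \<open>Shuffle signs\<close>

text \<open>The permutation that has the list as its list of values, as in the definition of the shuffle sign. Signs are
  computed by moving single entries through the list.\<close>

definition list_perm :: "nat list \<Rightarrow> nat \<Rightarrow> nat" where
  "list_perm xs m = (if m < length xs then xs ! m else m)"

lemma list_perm_upt [simp]: "list_perm [0..<n] = id"
  by (auto simp: list_perm_def)

lemma permutation_list_perm:
  assumes "distinct xs" "set xs = {0..<length xs}"
  shows "permutation (list_perm xs)"
proof -
  have "bij_betw ((!) xs) {..<length xs} {..<length xs}"
    using bij_betw_nth[OF assms(1), of "{..<length xs}" "set xs"] assms(2)
    by (simp add: lessThan_atLeast0)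
  then have "bij_betw (list_perm xs) {..<length xs} {..<length xs}"
    by (rule iffD1[OF bij_betw_cong, rotated]) (simp add: list_perm_def)
  then have "list_perm xs permutes {..<length xs}"
    by (rule bij_imp_permutes) (simp add: list_perm_def)
  then show ?thesis by (rule permutes_imp_permutation[rotated]) simp
qed

lemma sign_list_perm_swap:
  assumes "distinct (us @ x # y # ws)" "set (us @ x # y # ws) = {0..<length (us @ x # y # ws)}"
  shows "sign (list_perm (us @ x # y # ws)) = - sign (list_perm (us @ y # x # ws))"
proof -
  let ?\<tau> = "transpose (length us) (Suc (length us))"
  have "list_perm (us @ x # y # ws) = list_perm (us @ y # x # ws) \<circ> ?\<tau>"
    by (auto simp: fun_eq_iff list_perm_def nth_append transpose_def nth_Cons' Suc_diff_le)
  moreover have "permutation (list_perm (us @ y # x # ws))"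
    using assms by (intro permutation_list_perm) auto
  ultimately show ?thesis
    by (simp add: sign_compose sign_swap_id permutation_swap_id)
qed

lemma sign_list_perm_move:
  assumes "distinct (us @ x # vs @ ws)" "set (us @ x # vs @ ws) = {0..<length (us @ x # vs @ ws)}"
  shows "sign (list_perm (us @ x # vs @ ws)) = (- 1) ^ length vs * sign (list_perm (us @ vs @ x # ws))"
  using assms
proof (induction vs arbitrary: us)
  case (Cons v vs)
  have "sign (list_perm (us @ x # (v # vs) @ ws)) = - sign (list_perm ((us @ [v]) @ x # vs @ ws))"
    using sign_list_perm_swap[of us x v "vs @ ws"] Cons.prems by simp
  also have "sign (list_perm ((us @ [v]) @ x # vs @ ws))
      = (- 1) ^ length vs * sign (list_perm ((us @ [v]) @ vs @ x # ws))"
    by (rule Cons.IH) (use Cons.prems in auto)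
  finally show ?case by simp
qed simp

lemma sorted_list_of_set_Diff1:
  assumes "i < n"
  shows "sorted_list_of_set ({0..<n} - {i}) = [0..<i] @ [Suc i..<n]"
proof -
  have "set ([0..<i] @ [Suc i..<n]) = {0..<n} - {i}" using assms by auto
  moreover have "sorted ([0..<i] @ [Suc i..<n])" "distinct ([0..<i] @ [Suc i..<n])"
    by (auto simp: sorted_append)
  ultimately show ?thesis
    using sorted_list_of_set.idem_if_sorted_distinct by metis
qed

lemma sorted_list_of_set_Diff2:
  assumes "a < b" "b < n"
  shows "sorted_list_of_set ({0..<n} - {a, b}) = [0..<a] @ [Suc a..<b] @ [Suc b..<n]"
proof -
  have "set ([0..<a] @ [Suc a..<b] @ [Suc b..<n]) = {0..<n} - {a, b}" using assms by auto
  moreover have "sorted ([0..<a] @ [Suc a..<b] @ [Suc b..<n])" "distinct ([0..<a] @ [Suc a..<b] @ [Suc b..<n])"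
    using assms by (auto simp: sorted_append)
  ultimately show ?thesis
    using sorted_list_of_set.idem_if_sorted_distinct by metis
qed

lemma shuffle_sign_eq_sign_list_perm:
  assumes "J \<subseteq> {0..<n}"
  shows "shuffle_sign n J = sign (list_perm (sorted_list_of_set J @ sorted_list_of_set ({0..<n} - J)))"
proof -
  have "length (sorted_list_of_set J @ sorted_list_of_set ({0..<n} - J)) = n"
    using assms card_mono[OF _ assms] by (simp add: card_Diff_subset finite_subset[OF assms])
  then show ?thesis unfolding shuffle_sign_def list_perm_def by simp
qed

lemma upt_split: "i < n \<Longrightarrow> [0..<n] = [0..<i] @ i # [Suc i..<n]"
  by (metis less_imp_le_nat upt_add_eq_append upt_conv_Cons zero_le le_add_diff_inverse)

lemma shuffle_sign_Diff1:
  assumes "i < n"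
  shows "shuffle_sign n ({0..<n} - {i}) = (- 1) ^ (n - Suc i)"
proof -
  have "{0..<n} - ({0..<n} - {i}) = {i}" using assms by auto
  then have "shuffle_sign n ({0..<n} - {i}) = sign (list_perm ([0..<i] @ [Suc i..<n] @ i # []))"
    using assms by (simp add: shuffle_sign_eq_sign_list_perm sorted_list_of_set_Diff1)
  moreover have "sign (list_perm ([0..<i] @ i # [Suc i..<n] @ []))
      = (- 1) ^ length [Suc i..<n] * sign (list_perm ([0..<i] @ [Suc i..<n] @ i # []))"
    by (rule sign_list_perm_move) (use assms in auto)
  moreover have "[0..<i] @ i # [Suc i..<n] @ [] = [0..<n]" using upt_split[OF assms] by simp
  ultimately have "1 = (- 1) ^ (n - Suc i) * shuffle_sign n ({0..<n} - {i})" by simp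
  then show ?thesis by (metis minus_one_mult_self mult.assoc mult.right_neutral mult_1)
qed

lemma shuffle_sign_pair:
  assumes "a < b" "b < n"
  shows "shuffle_sign n {a, b} = (- 1) ^ (a + b - 1)"
proof -
  have s: "sorted_list_of_set {a, b} = [a, b]" using assms by simp
  have "shuffle_sign n {a, b} = sign (list_perm ([a] @ b # ([0..<a] @ [Suc a..<b]) @ [Suc b..<n]))"
    using assms by (subst shuffle_sign_eq_sign_list_perm) (auto simp: sorted_list_of_set_Diff2 s)
  also have "\<dots> = (- 1) ^ length ([0..<a] @ [Suc a..<b])
      * sign (list_perm ([a] @ ([0..<a] @ [Suc a..<b]) @ b # [Suc b..<n]))"
    by (rule sign_list_perm_move) (use assms in auto)
  also have "[a] @ ([0..<a] @ [Suc a..<b]) @ b # [Suc b..<n] = [] @ a # [0..<a] @ ([Suc a..<b] @ b # [Suc b..<n])"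
    by simp
  also have "sign (list_perm \<dots>) = (- 1) ^ length [0..<a]
      * sign (list_perm ([] @ [0..<a] @ a # ([Suc a..<b] @ b # [Suc b..<n])))"
    by (rule sign_list_perm_move) (use assms in auto)
  also have "[] @ [0..<a] @ a # ([Suc a..<b] @ b # [Suc b..<n]) = [0..<n]"
    using upt_split[of b n] upt_split[of a b] assms by simp
  finally show ?thesis
    using assms by (simp add: power_add[symmetric] add.commute)
qed

lemma map_nth_upt: "i \<le> j \<Longrightarrow> j \<le> length xs \<Longrightarrow> map ((!) xs) [i..<j] = take (j - i) (drop i xs)"
  by (rule nth_equalityI) auto

lemma map_nth_delete:
  "i < length xs \<Longrightarrow> map ((!) xs) ([0..<i] @ [Suc i..<length xs]) = take i xs @ drop (Suc i) xs"
  by (simp add: map_nth_upt)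

section \<open>Compositions with a ternary bracket\<close>

context vector_space
begin

text \<open>If \<open>I\<close> is a singleton, the shuffles are parametrised by the omitted index \<open>a\<close>: \<open>I = {p + 1}\<close> gives the
  first two terms, and \<open>I = {a}\<close> with \<open>a \<le> p\<close> the term in which the \<open>a\<close>-th wedge acts on a value of \<open>\<alpha>\<close>.\<close>

lemma circ_1_left:
  assumes len: "length Xs = p + 1"
  shows "circ scale 1 p \<omega> \<alpha> Xs z =
      (\<omega> [(\<alpha> (butlast Xs) (fst (last Xs)), snd (last Xs))] z
        + \<omega> [(fst (last Xs), \<alpha> (butlast Xs) (snd (last Xs)))] z)
    + (\<Sum>a<p + 1. scale ((- 1) ^ (p + a)) (\<omega> [Xs ! a] (\<alpha> (take a Xs @ drop (Suc a) Xs) z)))"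
proof -
  have J1: "{J. J \<subseteq> {0..<1 + p + 1} \<and> card J = p + 1 \<and> Max J < 1 + p} = {{0..<p + 1}}"
  proof (intro equalityI subsetI)
    fix J assume "J \<in> {J. J \<subseteq> {0..<1 + p + 1} \<and> card J = p + 1 \<and> Max J < 1 + p}"
    then have J: "J \<subseteq> {0..<1 + p + 1}" "card J = p + 1" "Max J < 1 + p" by auto
    have f: "finite J" using J(1) finite_subset by blast
    have "x < p + 1" if "x \<in> J" for x using Max_ge[OF f that] J(3) by simp
    then have "J \<subseteq> {0..<p + 1}" by auto
    then show "J \<in> {{0..<p + 1}}" using J(2) card_subset_eq[of "{0..<p + 1}" J] by auto
  next
    have "Max {0..<p + 1} = p" by (rule Max_eqI) auto
    then show "J \<in> {J. J \<subseteq> {0..<1 + p + 1} \<and> card J = p + 1 \<and> Max J < 1 + p}" if "J \<in> {{0..<p + 1}}" for J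
      using that by auto
  qed
  have J2: "{J. J \<subseteq> {0..<1 + p + 1} \<and> card J = p + 1 \<and> Max J = 1 + p}
      = (\<lambda>i. {0..<1 + p + 1} - {i}) ` {..<p + 1}"
  proof (intro equalityI subsetI)
    fix J assume "J \<in> {J. J \<subseteq> {0..<1 + p + 1} \<and> card J = p + 1 \<and> Max J = 1 + p}"
    then have J: "J \<subseteq> {0..<1 + p + 1}" "card J = p + 1" "Max J = 1 + p" by auto
    have f: "finite J" using J(1) finite_subset by blast
    have "card ({0..<1 + p + 1} - J) = 1" using J f by (simp add: card_Diff_subset)
    then obtain i where i: "{0..<1 + p + 1} - J = {i}" by (rule card_1_singletonE)
    have "J \<noteq> {}" using J(2) by auto
    then have "1 + p \<in> J" using Max_in[OF f] unfolding J(3) by blast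
    moreover have i': "i \<in> {0..<1 + p + 1}" "i \<notin> J" using i by blast+
    ultimately have "i \<noteq> 1 + p" by blast
    then have "i < p + 1" using i'(1) by simp
    moreover have "J = {0..<1 + p + 1} - {i}" using i J(1) by blast
    ultimately show "J \<in> (\<lambda>i. {0..<1 + p + 1} - {i}) ` {..<p + 1}" by blast
  next
    fix J assume "J \<in> (\<lambda>i. {0..<1 + p + 1} - {i}) ` {..<p + 1}"
    then obtain i where i: "i < p + 1" "J = {0..<1 + p + 1} - {i}" by auto
    have "Max J = 1 + p" using i by (intro Max_eqI) auto
    moreover have "card J = p + 1" using i by (simp add: card_Diff_subset)
    ultimately show "J \<in> {J. J \<subseteq> {0..<1 + p + 1} \<and> card J = p + 1 \<and> Max J = 1 + p}" using i by auto
  qed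
  have inj: "inj_on (\<lambda>i. {0..<1 + p + 1} - {i}) {..<p + 1}"
  proof (rule inj_onI)
    fix i i' assume "i \<in> {..<p + 1}" and eq: "{0..<1 + p + 1} - {i} = {0..<1 + p + 1} - {i'}"
    then have "i \<in> {0..<1 + p + 1}" by simp
    with eq show "i = i'" by blast
  qed
  have Mx: "Max ({0..<p + 1}) = p" by (rule Max_eqI) auto
  have sg1: "shuffle_sign (1 + p + 1) {0..<p + 1} = 1"
  proof -
    have "{0..<p + 1} = {0..<1 + p + 1} - {p + 1}" by auto
    then show ?thesis using shuffle_sign_Diff1[of "p + 1" "1 + p + 1"] by simp
  qed
  have I1: "{0..<1 + p + 1} - {0..<p + 1} = {p + 1}" by auto
  have bl: "map ((!) Xs) [0..<p] = butlast Xs"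
    using len by (simp add: map_nth_upt butlast_conv_take)
  have la: "Xs ! p = last Xs" using len by (metis add_diff_cancel_right' last_conv_nth list.size(3) zero_neq_one add_eq_0_iff_both_eq_0)
  have c: "card {i \<in> {p + 1}. i < p} = 0" by auto
  have 2: "(let js = map ((!) Xs) (butlast (sorted_list_of_set J));
          I = {0..<1 + p + 1} - J;
          is = map ((!) Xs) (sorted_list_of_set I)
        in scale (of_int (shuffle_sign (1 + p + 1) J) * (- 1) ^ 1) (\<omega> is (\<alpha> js z)))
      = scale ((- 1) ^ (p + a)) (\<omega> [Xs ! a] (\<alpha> (take a Xs @ drop (Suc a) Xs) z))"
    if a: "a < p + 1" and J: "J = {0..<1 + p + 1} - {a}" for a J
  proof -
    have I: "{0..<1 + p + 1} - J = {a}" using a J by auto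
    have "butlast (sorted_list_of_set J) = [0..<a] @ [Suc a..<p + 1]"
      unfolding J using a by (subst sorted_list_of_set_Diff1) (auto simp: butlast_append)
    then have js: "map ((!) Xs) (butlast (sorted_list_of_set J)) = take a Xs @ drop (Suc a) Xs"
      using map_nth_delete[of a Xs] a len by simp
    have is': "map ((!) Xs) (sorted_list_of_set {a}) = [Xs ! a]" by simp
    have "(- 1 :: 'a) ^ (1 + p + 1 - Suc a) * (- 1) ^ 1 = (- 1) ^ (p + a)"
    proof -
      \<comment> \<open>The exponents differ by \<open>2 (a - 1)\<close>; for \<open>a = 0\<close> the subtraction would truncate.\<close>
      have "(- 1 :: 'a) ^ (p + a) = (- 1) ^ (1 + p + 1 - Suc a + 1 + 2 * (a - 1))" if "a > 0"
        using that a by (intro arg_cong[where f = "(^) (- 1)"]) auto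
      then show ?thesis by (cases "a = 0") (simp_all add: power_add power_mult)
    qed
    moreover have "shuffle_sign (1 + p + 1) J = (- 1) ^ (1 + p + 1 - Suc a)"
      unfolding J using a by (intro shuffle_sign_Diff1) auto
    ultimately have sg: "of_int (shuffle_sign (1 + p + 1) J) * (- 1 :: 'a) ^ 1 = (- 1) ^ (p + a)"
      by simp
    show ?thesis unfolding Let_def I js is' sg ..
  qed
  have 1: "(let js = map ((!) Xs) (butlast (sorted_list_of_set J));
          j = Max J;
          xj = fst (Xs ! j);
          yj = snd (Xs ! j);
          I = {0..<1 + p + 1} - J;
          is = map ((!) Xs) (butlast (sorted_list_of_set I));
          k = card {i \<in> I. i < j}
        in scale (of_int (shuffle_sign (1 + p + 1) J) * (- 1) ^ k)
             (\<omega> (take k is @ [(\<alpha> js xj, yj)] @ drop k is) z +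
              \<omega> (take k is @ [(xj, \<alpha> js yj)] @ drop k is) z))
      = \<omega> [(\<alpha> (butlast Xs) (fst (last Xs)), snd (last Xs))] z
        + \<omega> [(fst (last Xs), \<alpha> (butlast Xs) (snd (last Xs)))] z" if "J = {0..<p + 1}" for J
    unfolding that Mx sg1 I1 c Let_def
    by (simp add: bl la)
  have nl: "\<not> length Xs \<noteq> 1 + p" using len by simp
  show ?thesis
    unfolding circ_def if_not_P[OF nl] J1 J2 sum.reindex[OF inj] comp_def
    by (intro arg_cong2[of _ _ _ _ "(+)"] sum.cong refl 2)
       (simp only: sum.insert finite.emptyI empty_iff not_False_eq_True sum.empty add_0_right 1[OF refl], auto)
qed

text \<open>If \<open>J = {a, b}\<close> with \<open>a < b\<close>, then the wedge \<open>a\<close> acts on the wedge \<open>b = a + 1 + c\<close>, or on the final argument for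
  \<open>b = p + 1\<close>. The sign of the shuffle and \<open>(-1)\<^sup>k\<close>, with \<open>k = b - 1\<close>, combine to \<open>(-1)\<^sup>a\<close>, independently of \<open>b\<close>. The
  position \<open>c\<close> counts from \<open>a + 1\<close>, as in the closed form of the Lie derivative.\<close>

lemma circ_1_right:
  assumes len: "length Xs = p + 1"
  shows "circ scale p 1 \<alpha> \<omega> Xs z =
    (\<Sum>a<p + 1. scale ((- 1) ^ a)
       ((\<Sum>c<p - a. \<alpha> (take a Xs @ (drop (Suc a) Xs)[c := (\<omega> [Xs ! a] (fst (drop (Suc a) Xs ! c)), snd (drop (Suc a) Xs ! c))]) z
             + \<alpha> (take a Xs @ (drop (Suc a) Xs)[c := (fst (drop (Suc a) Xs ! c), \<omega> [Xs ! a] (snd (drop (Suc a) Xs ! c)))]) z)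
        + \<alpha> (take a Xs @ drop (Suc a) Xs) (\<omega> [Xs ! a] z)))"
proof -
  let ?f = "\<lambda>(a, c). {a, Suc a + c}"
  let ?S = "Sigma {..<p + 1} (\<lambda>a. {..<p - a})"
  have two: "\<exists>a b. a < b \<and> J = {a, b}" if c: "card J = Suc 0 + 1" for J :: "nat set"
  proof -
    have "card J = 2" using c by simp
    then obtain a b where "J = {a, b}" "a \<noteq> b" unfolding card_2_iff by blast
    then show ?thesis by (metis insert_commute linorder_neqE_nat)
  qed
  have J1: "{J. J \<subseteq> {0..<p + 1 + 1} \<and> card J = 1 + 1 \<and> Max J < p + 1} = ?f ` ?S"
  proof (intro equalityI subsetI)
    fix J assume "J \<in> {J. J \<subseteq> {0..<p + 1 + 1} \<and> card J = 1 + 1 \<and> Max J < p + 1}"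
    then have J: "card J = Suc 0 + 1" "Max J < p + 1" by simp_all
    then obtain a b where "a < b" "J = {a, b}" using two by blast
    with J(2) have "a < b" "J = {a, b}" "b < p + 1" by simp_all
    then show "J \<in> ?f ` ?S" by (intro image_eqI[of _ _ "(a, b - Suc a)"]) auto
  qed auto
  have J2: "{J. J \<subseteq> {0..<p + 1 + 1} \<and> card J = 1 + 1 \<and> Max J = p + 1} = (\<lambda>a. {a, p + 1}) ` {..<p + 1}"
  proof (intro equalityI subsetI)
    fix J assume "J \<in> {J. J \<subseteq> {0..<p + 1 + 1} \<and> card J = 1 + 1 \<and> Max J = p + 1}"
    then have J: "card J = Suc 0 + 1" "Max J = p + 1" by simp_all
    then obtain a b where "a < b" "J = {a, b}" using two by blast
    with J(2) have "a < b" "J = {a, b}" "b = p + 1" by simp_all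
    then show "J \<in> (\<lambda>a. {a, p + 1}) ` {..<p + 1}" by (intro image_eqI[of _ _ a]) auto
  qed auto
  have "a = a' \<and> c = c'" if "{a, Suc a + c} = {a', Suc a' + c'}" for a c a' c'
    using that unfolding doubleton_eq_iff by linarith
  then have inj1: "inj_on ?f ?S" by (intro inj_onI) (simp split: prod.splits)
  have inj2: "inj_on (\<lambda>a. {a, p + 1}) {..<p + 1}" by (rule inj_onI) (auto simp: doubleton_eq_iff)
  let ?A = "\<lambda>a c. \<alpha> (take a Xs @ (drop (Suc a) Xs)[c := (\<omega> [Xs ! a] (fst (drop (Suc a) Xs ! c)), snd (drop (Suc a) Xs ! c))]) z
             + \<alpha> (take a Xs @ (drop (Suc a) Xs)[c := (fst (drop (Suc a) Xs ! c), \<omega> [Xs ! a] (snd (drop (Suc a) Xs ! c)))]) z"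
  have 1: "(let js = map ((!) Xs) (butlast (sorted_list_of_set J));
          j = Max J;
          xj = fst (Xs ! j);
          yj = snd (Xs ! j);
          I = {0..<p + 1 + 1} - J;
          is = map ((!) Xs) (butlast (sorted_list_of_set I));
          k = card {i \<in> I. i < j}
        in scale (of_int (shuffle_sign (p + 1 + 1) J) * (- 1) ^ k)
             (\<alpha> (take k is @ [(\<omega> js xj, yj)] @ drop k is) z +
              \<alpha> (take k is @ [(xj, \<omega> js yj)] @ drop k is) z))
      = scale ((- 1) ^ a) (?A a c)" if a: "a < p + 1" and c: "c < p - a" and J: "J = {a, Suc a + c}" for a c J
  proof -
    let ?b = "Suc a + c"
    have ab: "a < ?b" "?b < p + 1" using a c by auto
    have js: "map ((!) Xs) (butlast (sorted_list_of_set J)) = [Xs ! a]" using J ab by simp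
    have M: "Max J = ?b" using J by simp
    have k: "card {i \<in> {0..<p + 1 + 1} - J. i < ?b} = a + c"
    proof -
      have "{i \<in> {0..<p + 1 + 1} - J. i < ?b} = {0..<?b} - {a}" using J ab by auto
      then show ?thesis by (simp add: card_Diff_subset)
    qed
    have "butlast (sorted_list_of_set ({0..<p + 1 + 1} - J)) = [0..<a] @ [Suc a..<?b] @ [Suc ?b..<p + 1]"
      unfolding J using ab by (subst sorted_list_of_set_Diff2) (auto simp: butlast_append)
    moreover have "map ((!) Xs) \<dots> = take a Xs @ take c (drop (Suc a) Xs) @ drop (Suc c) (drop (Suc a) Xs)"
      using ab len by (simp add: map_nth_upt add.commute del: upt_Suc)
    ultimately have is': "map ((!) Xs) (butlast (sorted_list_of_set ({0..<p + 1 + 1} - J)))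
        = take a Xs @ take c (drop (Suc a) Xs) @ drop (Suc c) (drop (Suc a) Xs)" by metis
    have upd: "(drop (Suc a) Xs)[c := P] = take c (drop (Suc a) Xs) @ P # drop (Suc c) (drop (Suc a) Xs)" for P
      using ab len by (intro upd_conv_take_nth_drop) simp
    have la: "length (take a Xs) = a" "length (take c (drop (Suc a) Xs)) = c" using ab len by auto
    have nth: "Xs ! ?b = drop (Suc a) Xs ! c" using ab len by simp
    have tk: "take (a + c) (take a Xs @ take c (drop (Suc a) Xs) @ drop (Suc c) (drop (Suc a) Xs))
        = take a Xs @ take c (drop (Suc a) Xs)"
      "drop (a + c) (take a Xs @ take c (drop (Suc a) Xs) @ drop (Suc c) (drop (Suc a) Xs))
        = drop (Suc c) (drop (Suc a) Xs)"
      using la by (simp_all del: length_take length_drop drop_drop)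
    have "shuffle_sign (p + 1 + 1) J = (- 1) ^ (a + ?b - 1)"
      unfolding J using ab by (intro shuffle_sign_pair) auto
    moreover have "(- 1 :: 'a) ^ (a + ?b - 1) * (- 1) ^ (a + c) = (- 1) ^ a"
      by (simp add: power_add[symmetric]) (simp add: power_add flip: mult_2 power_mult)
    ultimately have sg: "of_int (shuffle_sign (p + 1 + 1) J) * (- 1 :: 'a) ^ (a + c) = (- 1) ^ a"
      by simp
    show ?thesis
      unfolding Let_def js M k is' tk sg upd nth by simp
  qed
  have 2: "(let js = map ((!) Xs) (butlast (sorted_list_of_set J));
          I = {0..<p + 1 + 1} - J;
          is = map ((!) Xs) (sorted_list_of_set I)
        in scale (of_int (shuffle_sign (p + 1 + 1) J) * (- 1) ^ p) (\<alpha> is (\<omega> js z)))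
      = scale ((- 1) ^ a) (\<alpha> (take a Xs @ drop (Suc a) Xs) (\<omega> [Xs ! a] z))"
    if a: "a < p + 1" and J: "J = {a, p + 1}" for a J
  proof -
    have js: "map ((!) Xs) (butlast (sorted_list_of_set J)) = [Xs ! a]" using J a by simp
    have "sorted_list_of_set ({0..<p + 1 + 1} - J) = [0..<a] @ [Suc a..<p + 1]"
      unfolding J using a by (subst sorted_list_of_set_Diff2) auto
    then have is': "map ((!) Xs) (sorted_list_of_set ({0..<p + 1 + 1} - J)) = take a Xs @ drop (Suc a) Xs"
      using map_nth_delete[of a Xs] a len by simp
    have "shuffle_sign (p + 1 + 1) J = (- 1) ^ (a + (p + 1) - 1)"
      unfolding J using a by (intro shuffle_sign_pair) auto
    moreover have "(- 1 :: 'a) ^ (a + (p + 1) - 1) * (- 1) ^ p = (- 1) ^ a"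
      by (simp add: power_add)
    ultimately have sg: "of_int (shuffle_sign (p + 1 + 1) J) * (- 1 :: 'a) ^ p = (- 1) ^ a"
      by simp
    show ?thesis unfolding Let_def js is' sg ..
  qed
  have nl: "\<not> length Xs \<noteq> p + 1" using len by simp
  have "circ scale p 1 \<alpha> \<omega> Xs z = (\<Sum>(a, c)\<in>?S. scale ((- 1) ^ a) (?A a c))
      + (\<Sum>a<p + 1. scale ((- 1) ^ a) (\<alpha> (take a Xs @ drop (Suc a) Xs) (\<omega> [Xs ! a] z)))"
    unfolding circ_def if_not_P[OF nl] J1 J2 sum.reindex[OF inj1] sum.reindex[OF inj2] comp_def
    by (intro arg_cong2[of _ _ _ _ "(+)"] sum.cong refl 2) (clarsimp simp only: SigmaE2 mem_Sigma_iff lessThan_iff prod.case; rule 1; simp)+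
  also have "(\<Sum>(a, c)\<in>?S. scale ((- 1) ^ a) (?A a c)) = (\<Sum>a<p + 1. \<Sum>c<p - a. scale ((- 1) ^ a) (?A a c))"
    by (rule sum.Sigma[symmetric]) auto
  finally show ?thesis
    by (simp only: scale_sum_right scale_right_distrib sum.distrib)
qed

end

section \<open>The differential as the coboundary of a 3-Lie algebra\<close>

text \<open>In degree one, \<open>[t, t] = -2 (t \<circ> t)\<close>, and the three shuffles in \<open>t \<circ> t\<close> give the four terms of the Fundamental
  Identity.\<close>

lemma fundamental_identity_of_bracket_eq_0:
  fixes s :: "'k::field_char_0 \<Rightarrow> 'w::ab_group_add \<Rightarrow> 'w"
  assumes "vector_space s"
    and MC: "bracket_3Lie s 1 1 (ternary_cochain t) (ternary_cochain t) = 0"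
  shows "t x1 x2 (t x3 x4 x5) = t (t x1 x2 x3) x4 x5 + t x3 (t x1 x2 x4) x5 + t x3 x4 (t x1 x2 x5)"
proof -
  interpret vector_space s by fact
  let ?\<Omega> = "ternary_cochain t" and ?Xs = "[(x1, x2), (x3, x4)]"
  let ?C = "circ s 1 1 ?\<Omega> ?\<Omega> ?Xs x5"
  have "s (- 1) ?C - ?C = 0"
    using fun_cong[OF fun_cong[OF MC], of ?Xs x5] by (simp add: bracket_3Lie_def cochain_scale_def)
  moreover have "s (1 + 1) ?C = - (s (- 1) ?C - ?C)"
    by (simp only: scale_left_distrib scale_one scale_minus_left) simp
  ultimately have "s (1 + 1) ?C = 0" by simp
  then have "?C = 0" by simp
  moreover have "?C = t (t x1 x2 x3) x4 x5 + t x3 (t x1 x2 x4) x5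
      + (- t x1 x2 (t x3 x4 x5) + t x3 x4 (t x1 x2 x5))"
    by (subst circ_1_left) (simp_all add: ternary_cochain_def numeral_2_eq_2)
  ultimately show ?thesis by (simp add: algebra_simps)
qed

context three_lie_algebra
begin

text \<open>The prefactor \<open>(-1)\<^sup>p\<close> turns the signs \<open>(-1)\<^sup>p\<^sup>+\<^sup>a\<close> of \<open>\<omega> \<circ> \<alpha>\<close> into \<open>(-1)\<^sup>a\<close>, so that the terms for the
  index \<open>a\<close> in both compositions combine to a Lie derivative along the \<open>a\<close>-th wedge.\<close>

lemma bracket_eq_coboundary:
  assumes "\<And>Xs z. length Xs \<noteq> p \<Longrightarrow> \<alpha> Xs z = 0"
  shows "bracket_3Lie s 1 p (ternary_cochain br) \<alpha> = coboundary \<alpha>"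
proof -
  have "bracket_3Lie s 1 p (ternary_cochain br) \<alpha> Xs z = coboundary \<alpha> Xs z" for Xs z
  proof (cases "length Xs = p + 1")
    case False
    then have "coboundary \<alpha> Xs z = 0" by (intro coboundary_vanish assms) auto
    with False show ?thesis by (simp add: bracket_3Lie_def cochain_scale_def circ_def)
  next
    case True
    then have ne: "Xs \<noteq> []" by auto
    have \<Omega>: "ternary_cochain br [X] = ad X" for X
      by (simp add: ternary_cochain_def fun_eq_iff split: prod.splits)
    have sgn: "s ((- 1) ^ p) (s ((- 1) ^ (p + a)) w) = s ((- 1) ^ a) w" for a w
      by (simp add: power_add)
    let ?T = "br (\<alpha> (butlast Xs) (fst (last Xs))) (snd (last Xs)) z
            + br (fst (last Xs)) (\<alpha> (butlast Xs) (snd (last Xs))) z"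
    let ?D = "\<lambda>a. take a Xs @ drop (Suc a) Xs"
    let ?A = "\<lambda>a. \<Sum>c<p - a. \<alpha> (take a Xs @ (drop (Suc a) Xs)[c := (ad (Xs ! a) (fst (drop (Suc a) Xs ! c)), snd (drop (Suc a) Xs ! c))]) z
             + \<alpha> (take a Xs @ (drop (Suc a) Xs)[c := (fst (drop (Suc a) Xs ! c), ad (Xs ! a) (snd (drop (Suc a) Xs ! c)))]) z"
    have lie: "lie_deriv (Xs ! a) (\<lambda>Zs. \<alpha> (take a Xs @ Zs)) (drop (Suc a) Xs) z
        = ad (Xs ! a) (\<alpha> (?D a) z) - ?A a - \<alpha> (?D a) (ad (Xs ! a) z)" for a
    proof -
      have "length (drop (Suc a) Xs) = p - a" using True by simp
      then show ?thesis by (simp only: lie_deriv_eq_sum)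
    qed
    have collect: "s ((- 1) ^ p) (w + (\<Sum>a<p + 1. s ((- 1) ^ (p + a)) (F a)))
          - (\<Sum>a<p + 1. s ((- 1) ^ a) (G a + H a))
        = (\<Sum>a<p + 1. s ((- 1) ^ a) (F a - G a - H a)) + s ((- 1) ^ p) w" for w F G H
      unfolding diff_diff_eq scale_right_distrib scale_right_diff_distrib scale_sum_right sgn
        sum_subtractf sum.distrib by (simp add: algebra_simps)
    have "bracket_3Lie s 1 p (ternary_cochain br) \<alpha> Xs z
      = s ((- 1) ^ p) (?T + (\<Sum>a<p + 1. s ((- 1) ^ (p + a)) (ad (Xs ! a) (\<alpha> (?D a) z))))
        - (\<Sum>a<p + 1. s ((- 1) ^ a) (?A a + \<alpha> (?D a) (ad (Xs ! a) z)))"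
      by (simp only: bracket_3Lie_def fun_diff_def cochain_scale_def circ_1_left[OF True] circ_1_right[OF True] \<Omega> fst_conv snd_conv mult_1)
    also have "\<dots> = (\<Sum>a<p + 1. s ((- 1) ^ a) (ad (Xs ! a) (\<alpha> (?D a) z) - ?A a - \<alpha> (?D a) (ad (Xs ! a) z)))
        + s ((- 1) ^ p) ?T"
      by (rule collect)
    also have "\<dots> = coboundary \<alpha> Xs z"
      by (simp only: coboundary_eq_sum lie True ne if_False add_diff_cancel_right')
    finally show ?thesis .
  qed
  then show ?thesis by (simp add: fun_eq_iff)
qed

text \<open>Outside degree \<open>p\<close> all conditions hold trivially, so the restrictions on the lengths of lists can be
  dropped.\<close>

lemma cochains_iff:
  "\<alpha> \<in> cochains s p \<longleftrightarrow> (\<forall>Xs z. length Xs \<noteq> p \<longrightarrow> \<alpha> Xs z = 0) \<and> multilin \<alpha> \<and> skew_last \<alpha>"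
proof (intro iffI conjI)
  assume \<alpha>: "\<alpha> \<in> cochains s p"
  show supp: "\<forall>Xs z. length Xs \<noteq> p \<longrightarrow> \<alpha> Xs z = 0" using \<alpha> unfolding cochains_def by blast
  show "multilin \<alpha>" unfolding multilin_def
  proof (intro conjI allI)
    show "endo (\<alpha> Xs)" for Xs
    proof (cases "length Xs = p")
      case True
      then show ?thesis using \<alpha> unfolding cochains_def by blast
    next
      case False
      then have "\<alpha> Xs = (\<lambda>z. 0)" using supp by blast
      then show ?thesis by (simp add: endo_0)
    qed
    show "alt_bilinear (\<lambda>P. \<alpha> (Xs @ P # Ys) z)" for Xs Ys z
    proof (cases "length Xs + 1 + length Ys = p")
      case True
      have "endo (\<lambda>x. \<alpha> (Xs @ [(x, y)] @ Ys) z)" "endo (\<lambda>x. \<alpha> (Xs @ [(y, x)] @ Ys) z)"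
        "\<alpha> (Xs @ [(y, x)] @ Ys) z = - \<alpha> (Xs @ [(x, y)] @ Ys) z" for x y
        using \<alpha> True unfolding cochains_def by blast+
      then show ?thesis unfolding alt_bilinear_def append_Cons append_Nil by blast
    next
      case False
      then have "(\<lambda>P. \<alpha> (Xs @ P # Ys) z) = (\<lambda>P. 0)" using supp by simp
      then show ?thesis by (simp add: alt_bilinear_0)
    qed
  qed
  show "skew_last \<alpha>" unfolding skew_last_def
  proof (intro allI)
    show "\<alpha> (Xs @ [(x, z)]) y = - \<alpha> (Xs @ [(x, y)]) z" for Xs x y z
    proof (cases "length Xs + 1 = p")
      case True
      then show ?thesis using \<alpha> unfolding cochains_def by blast
    next
      case False
      then show ?thesis using supp by simp
    qed
  qed
next
  assume "(\<forall>Xs z. length Xs \<noteq> p \<longrightarrow> \<alpha> Xs z = 0) \<and> multilin \<alpha> \<and> skew_last \<alpha>"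
  then show "\<alpha> \<in> cochains s p"
    unfolding cochains_def multilin_def skew_last_def alt_bilinear_def append_Cons append_Nil
    by blast
qed

lemma cochains_coboundary:
  assumes "\<alpha> \<in> cochains s p"
  shows "coboundary \<alpha> \<in> cochains s (p + 1)"
  using assms unfolding cochains_iff
  by (auto intro: coboundary_vanish multilin_coboundary skew_last_coboundary)

lemma cochains_0: "0 \<in> cochains s p"
  by (simp add: cochains_iff multilin_def skew_last_def endo_0[folded func_zero] alt_bilinear_0)

lemma cochains_add:
  assumes "\<alpha> \<in> cochains s p" "\<beta> \<in> cochains s p"
  shows "\<alpha> + \<beta> \<in> cochains s p"
proof -
  have "multilin (\<alpha> + \<beta>)"
    using assms by (simp add: cochains_iff multilin_def func_plus endo_add alt_bilinear_add)
  moreover have "skew_last (\<alpha> + \<beta>)"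
    unfolding skew_last_def
  proof (intro allI)
    show "(\<alpha> + \<beta>) (Xs @ [(x, z)]) y = - (\<alpha> + \<beta>) (Xs @ [(x, y)]) z" for Xs x y z
      using skew_lastD[of \<alpha> Xs x z y] skew_lastD[of \<beta> Xs x z y] assms by (simp add: cochains_iff)
  qed
  ultimately show ?thesis using assms by (simp add: cochains_iff)
qed

lemma cochains_scale:
  assumes "\<alpha> \<in> cochains s p"
  shows "cochain_scale s c \<alpha> \<in> cochains s p"
proof -
  have c: "endo (s c)" by (simp add: endo_iff scale_right_distrib scale_left_commute)
  have "multilin (cochain_scale s c \<alpha>)"
    using assms by (simp add: cochains_iff multilin_def cochain_scale_def endo_comp[OF c] alt_bilinear_comp[OF c])
  moreover have "skew_last (cochain_scale s c \<alpha>)"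
    unfolding skew_last_def
  proof (intro allI)
    show "cochain_scale s c \<alpha> (Xs @ [(x, z)]) y = - cochain_scale s c \<alpha> (Xs @ [(x, y)]) z" for Xs x y z
      using skew_lastD[of \<alpha> Xs x z y] assms by (simp add: cochains_iff cochain_scale_def)
  qed
  ultimately show ?thesis using assms by (simp add: cochains_iff cochain_scale_def)
qed

lemma vector_space_cochain_scale: "vector_space (cochain_scale s)"
  by unfold_locales (auto simp: cochain_scale_def fun_eq_iff scale_right_distrib scale_left_distrib)

end

text \<open>The ternary bracket \<open>\<pi> + \<rho> + \<nu>\<close> on \<open>\<gg> \<oplus> V\<close>.\<close>

definition semidirect_br ::
  "('g \<Rightarrow> 'g \<Rightarrow> 'g \<Rightarrow> 'g) \<Rightarrow> ('g \<Rightarrow> 'g \<Rightarrow> 'v \<Rightarrow> 'v) \<Rightarrow> ('g \<Rightarrow> 'v \<Rightarrow> 'v \<Rightarrow> 'v)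
    \<Rightarrow> 'g \<times> 'v \<Rightarrow> 'g \<times> 'v \<Rightarrow> 'g \<times> 'v \<Rightarrow> 'g \<times> ('v::ab_group_add)" where
  "semidirect_br br \<rho> \<nu> X Y Z =
     (br (fst X) (fst Y) (fst Z),
      \<rho> (fst X) (fst Y) (snd Z) + \<rho> (fst Y) (fst Z) (snd X) + \<rho> (fst Z) (fst X) (snd Y)
      + (\<nu> (fst X) (snd Y) (snd Z) + \<nu> (fst Y) (snd Z) (snd X) + \<nu> (fst Z) (snd X) (snd Y)))"

lemma ternary_cochain_semidirect_br:
  "pi_bar br + rho_bar \<rho> + nu_bar \<nu> = ternary_cochain (semidirect_br br \<rho> \<nu>)"
proof (intro ext)
  fix Xs z
  show "(pi_bar br + rho_bar \<rho> + nu_bar \<nu>) Xs z = ternary_cochain (semidirect_br br \<rho> \<nu>) Xs z"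
    by (cases z) (auto simp: pi_bar_def rho_bar_def nu_bar_def ternary_cochain_def semidirect_br_def
        zero_prod_def split: list.splits)
qed

context generalized_representation
begin

lemma vector_space_prod: "vector_space_prod sg sv"
  by unfold_locales

lemma rho_add_scale:
  "\<rho> (x + x') y w = \<rho> x y w + \<rho> x' y w" "\<rho> x (y + y') w = \<rho> x y w + \<rho> x y' w"
  "\<rho> x y (w + w') = \<rho> x y w + \<rho> x y w'"
  "\<rho> (sg c x) y w = sv c (\<rho> x y w)" "\<rho> x (sg c y) w = sv c (\<rho> x y w)"
  "\<rho> x y (sv c w) = sv c (\<rho> x y w)"
  using rho_linear1 rho_linear2 rho_gl by (auto simp: Vector_Spaces.linear_iff)

lemma nu_add_scale:
  "\<nu> (x + x') v w = \<nu> x v w + \<nu> x' v w" "\<nu> x (v + v') w = \<nu> x v w + \<nu> x v' w"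
  "\<nu> x v (w + w') = \<nu> x v w + \<nu> x v w'"
  "\<nu> (sg c x) v w = sv c (\<nu> x v w)" "\<nu> x (sv c v) w = sv c (\<nu> x v w)"
  "\<nu> x v (sv c w) = sv c (\<nu> x v w)"
  using nu_linear1 nu_linear2 nu_linear3 by (auto simp: Vector_Spaces.linear_iff)

lemma semidirect_br_linear:
  "Vector_Spaces.linear (module_prod.scale sg sv) (module_prod.scale sg sv) (\<lambda>X. semidirect_br br \<rho> \<nu> X Y Z)"
  "Vector_Spaces.linear (module_prod.scale sg sv) (module_prod.scale sg sv) (\<lambda>Y. semidirect_br br \<rho> \<nu> X Y Z)"
  "Vector_Spaces.linear (module_prod.scale sg sv) (module_prod.scale sg sv) (\<lambda>Z. semidirect_br br \<rho> \<nu> X Y Z)"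
proof -
  interpret P: vector_space_prod sg sv by (rule vector_space_prod)
  show "Vector_Spaces.linear P.scale P.scale (\<lambda>X. semidirect_br br \<rho> \<nu> X Y Z)"
    "Vector_Spaces.linear P.scale P.scale (\<lambda>Y. semidirect_br br \<rho> \<nu> X Y Z)"
    "Vector_Spaces.linear P.scale P.scale (\<lambda>Z. semidirect_br br \<rho> \<nu> X Y Z)"
    using P.p.vector_space_axioms
    by (simp_all add: Vector_Spaces.linear_iff P.scale_def semidirect_br_def rho_add_scale nu_add_scale
        br_add br_scale V.scale_right_distrib)
qed

lemma semidirect_br_skew:
  "semidirect_br br \<rho> \<nu> Y X Z = - semidirect_br br \<rho> \<nu> X Y Z"
  "semidirect_br br \<rho> \<nu> X Z Y = - semidirect_br br \<rho> \<nu> X Y Z"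
  by (simp_all add: semidirect_br_def prod_eq_iff
      skew12[of "fst Y" "fst X"] skew23[of "fst X" "fst Z" "fst Y"]
      rho_skew[of "fst Y" "fst X"] rho_skew[of "fst Z" "fst Y"] rho_skew[of "fst X" "fst Z"]
      nu_skew[of _ "snd X" "snd Z"] nu_skew[of _ "snd Z" "snd Y"] nu_skew[of _ "snd Y" "snd X"])

end

lemma three_lie_algebra_semidirect:
  fixes sg :: "'k::field_char_0 \<Rightarrow> 'g::ab_group_add \<Rightarrow> 'g" and sv :: "'k \<Rightarrow> 'v::ab_group_add \<Rightarrow> 'v"
  assumes "generalized_representation sg br sv \<rho> \<nu>"
  shows "three_lie_algebra (module_prod.scale sg sv) (semidirect_br br \<rho> \<nu>)"
proof -
  interpret generalized_representation sg br sv \<rho> \<nu> by fact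
  interpret P: vector_space_prod sg sv by (rule vector_space_prod)
  show ?thesis
    by (intro three_lie_algebra.intro three_lie_algebra_axioms.intro P.p.vector_space_axioms
        semidirect_br_linear semidirect_br_skew
        fundamental_identity_of_bracket_eq_0[OF P.p.vector_space_axioms]
        maurer_cartan[unfolded ternary_cochain_semidirect_br])
qed

theorem theorem4p1:
  fixes sg :: "'k::{alg_closed_field, field_char_0} \<Rightarrow> 'g::ab_group_add \<Rightarrow> 'g"
    and sv :: "'k \<Rightarrow> 'v::ab_group_add \<Rightarrow> 'v"
    and br :: "'g \<Rightarrow> 'g \<Rightarrow> 'g \<Rightarrow> 'g"
    and \<rho> :: "'g \<Rightarrow> 'g \<Rightarrow> 'v \<Rightarrow> 'v"
    and \<nu> :: "'g \<Rightarrow> 'v \<Rightarrow> 'v \<Rightarrow> 'v"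
  assumes "three_lie_algebra sg br"
    and "generalized_representation sg br sv \<rho> \<nu>"
  shows "(\<forall>p. \<forall>\<alpha> \<in> V_cochains_gt sg sv p.
            gen_rep_d sg sv br \<rho> \<nu> p \<alpha> \<in> V_cochains_gt sg sv (p + 1) \<and>
            gen_rep_d sg sv br \<rho> \<nu> (p + 1) (gen_rep_d sg sv br \<rho> \<nu> p \<alpha>) = 0)
         \<and> cochain_complex_from 1 (cochain_scale (module_prod.scale sg sv))
             (\<lambda>p. V_cochains_gt sg sv (p - 1)) (\<lambda>p. gen_rep_d sg sv br \<rho> \<nu> (p - 1))"
proof -
  interpret G: generalized_representation sg br sv \<rho> \<nu> by fact
  interpret P: vector_space_prod sg sv by (rule G.vector_space_prod)
  let ?s = "module_prod.scale sg sv"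
  interpret W: three_lie_algebra ?s "semidirect_br br \<rho> \<nu>"
    by (rule three_lie_algebra_semidirect) fact
  interpret C: vector_space "cochain_scale ?s" by (rule W.vector_space_cochain_scale)
  let ?V = "{w :: 'g \<times> 'v. fst w = 0}"
  let ?C = "V_cochains_gt sg sv" and ?d = "gen_rep_d sg sv br \<rho> \<nu>"
  have C_iff: "\<alpha> \<in> ?C p \<longleftrightarrow> \<alpha> \<in> cochains ?s p \<and> (\<forall>Xs x. \<alpha> Xs x \<in> ?V)
      \<and> (\<forall>Xs x. set Xs \<subseteq> ?V \<times> ?V \<longrightarrow> x \<in> ?V \<longrightarrow> \<alpha> Xs x = 0)" for \<alpha> p
  proof -
    have "(\<forall>(a, b)\<in>set Xs. fst a = 0 \<and> fst b = 0) \<longleftrightarrow> set Xs \<subseteq> ?V \<times> ?V" for Xs :: "(('g \<times> 'v) \<times> 'g \<times> 'v) list"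
      by auto
    then show ?thesis unfolding V_cochains_gt_def V_cochains_def by simp
  qed
  have d_eq: "?d p \<alpha> = W.coboundary \<alpha>" if "\<alpha> \<in> ?C p" for \<alpha> p
    unfolding gen_rep_d_def ternary_cochain_semidirect_br
    by (rule W.bracket_eq_coboundary) (use that in \<open>unfold C_iff W.cochains_iff, blast\<close>)
  have V: "P.p.subspace ?V" by (simp add: P.p.subspace_def P.scale_def)
  have rho0: "\<rho> 0 y w = 0" "\<rho> x 0 w = 0" "\<rho> x y 0 = 0" and nu0: "\<nu> 0 v w = 0" for x y v w
    using G.rho_add_scale(4)[of 0 0] G.rho_add_scale(5)[of _ 0 0] G.rho_add_scale(6)[of _ _ 0 0] G.nu_add_scale(4)[of 0 0]
    by simp_all
  have d_mem: "?d p \<alpha> \<in> ?C (p + 1)" if \<alpha>: "\<alpha> \<in> ?C p" for \<alpha> p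
    unfolding d_eq[OF \<alpha>] C_iff
  proof (intro conjI allI impI)
    show "W.coboundary \<alpha> \<in> cochains ?s (p + 1)"
      using \<alpha> by (intro W.cochains_coboundary) (simp add: C_iff)
    show "W.coboundary \<alpha> Xs x \<in> ?V" for Xs x
      by (rule W.coboundary_in_ideal[OF V]) (use \<alpha> in \<open>auto simp: semidirect_br_def C_iff\<close>)
    show "W.coboundary \<alpha> Xs x = 0" if "set Xs \<subseteq> ?V \<times> ?V" "x \<in> ?V" for Xs x
      by (rule W.coboundary_vanish_on_abelian[of ?V])
        (use \<alpha> that in \<open>auto simp: semidirect_br_def C_iff rho0 nu0 zero_prod_def\<close>)
  qed
  have dd: "?d (p + 1) (?d p \<alpha>) = 0" if \<alpha>: "\<alpha> \<in> ?C p" for \<alpha> p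
    unfolding d_eq[OF d_mem[OF \<alpha>]] unfolding d_eq[OF \<alpha>]
    using \<alpha> by (intro W.coboundary_coboundary) (simp add: C_iff W.cochains_iff)
  have sub: "C.subspace (?C p)" for p
  proof (rule C.subspaceI)
    show "0 \<in> ?C p" by (simp add: C_iff W.cochains_0)
    show "\<alpha> + \<beta> \<in> ?C p" if "\<alpha> \<in> ?C p" "\<beta> \<in> ?C p" for \<alpha> \<beta>
      using that W.cochains_add[of \<alpha> p \<beta>] by (simp add: C_iff)
    show "cochain_scale ?s c \<alpha> \<in> ?C p" if "\<alpha> \<in> ?C p" for c \<alpha>
      using that W.cochains_scale[of \<alpha> p c] by (simp add: C_iff) (simp add: cochain_scale_def P.scale_def zero_prod_def)
  qed
  have add: "?d p (\<alpha> + \<beta>) = ?d p \<alpha> + ?d p \<beta>" if "\<alpha> \<in> ?C p" "\<beta> \<in> ?C p" for \<alpha> \<beta> p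
    using that C.subspace_add[OF sub that] by (simp add: d_eq W.coboundary_add)
  have scl: "?d p (cochain_scale ?s c \<alpha>) = cochain_scale ?s c (?d p \<alpha>)" if "\<alpha> \<in> ?C p" for \<alpha> c p
    using that C.subspace_scale[OF sub that] by (simp add: d_eq W.coboundary_scale)
  show ?thesis
  proof (intro conjI allI ballI)
    show "?d p \<alpha> \<in> ?C (p + 1)" "?d (p + 1) (?d p \<alpha>) = 0" if "\<alpha> \<in> ?C p" for p \<alpha>
      using that by (fact d_mem, fact dd)
    have n: "n + 1 - 1 = n - 1 + 1" if "1 \<le> n" for n :: nat using that by simp
    show "cochain_complex_from 1 (cochain_scale ?s) (\<lambda>p. ?C (p - 1)) (\<lambda>p. ?d (p - 1))"
      unfolding cochain_complex_from_def
    proof (intro conjI allI impI ballI)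
      show "vector_space (cochain_scale ?s)" by (rule C.vector_space_axioms)
      show "C.subspace (?C (n - 1))" for n by (rule sub)
    qed (simp_all only: n d_mem dd add scl)
  qed
qed

end
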